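(* For every integer $T\ge 3$, the semigroup $\mathbb N A^T$ generated by the columns of $A^T$ is normal, i.e. $\mathbb N A^T=\mathbb Z A^T\cap \mathrm{cone}(A^T)$.
   Context: For an integer $T\ge 2$, let $\Omega_T$ be the set of words $w=s_1s_2\cdots s_T$ over the alphabet $\{1,2,3\}$ with $s_l\neq s_{l+1}$ for $l=1,\dots,T-1$. For $w\in\Omega_T$ and an ordered pair $ij$ with $i\neq j$, let $x_{ij}(w)$ be the number of indices $1\le l\le T-1$ with $s_ls_{l+1}=ij$. The design matrix $A^T$ is the $6\times 3\cdot 2^{T-1}$ matrix whose column indexed by $w\in\Omega_T$ is $[x_{12}(w),x_{13}(w),x_{21}(w),x_{23}(w),x_{31}(w),x_{32}(w)]$. $\mathbb N A^T$ denotes the set of nonnegative integer combinations of the columns, $\mathbb ZA^T$ the set of integer combinations, and $\mathrm{cone}(A^T)$ the set of nonnegative real combinations. *)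

theory Defs
  imports Main "HOL.Real"
begin

definition Omega :: "nat \<Rightarrow> nat list set" where
  "Omega T = {w. length w = T \<and> set w \<subseteq> {1,2,3} \<and>
                 (\<forall>l. Suc l < T \<longrightarrow> w ! l \<noteq> w ! Suc l)}"

definition Pairs :: "(nat \<times> nat) set" where
  "Pairs = {(1,2),(1,3),(2,1),(2,3),(3,1),(3,2)}"

definition xcount :: "nat \<times> nat \<Rightarrow> nat list \<Rightarrow> nat" where
  "xcount p w = card {l. Suc l < length w \<and> w ! l = fst p \<and> w ! Suc l = snd p}"

text \<open>Column of A^T indexed by w, as a vector in R^6 with coordinates indexed by Pairs
  (coordinates outside Pairs are 0).\<close>
definition col :: "nat list \<Rightarrow> (nat \<times> nat) \<Rightarrow> real" where
  "col w p = (if p \<in> Pairs then real (xcount p w) else 0)"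

definition NA :: "nat \<Rightarrow> ((nat \<times> nat) \<Rightarrow> real) set" where
  "NA T = {v. \<exists>c :: nat list \<Rightarrow> nat. v = (\<lambda>p. \<Sum>w\<in>Omega T. real (c w) * col w p)}"

definition ZA :: "nat \<Rightarrow> ((nat \<times> nat) \<Rightarrow> real) set" where
  "ZA T = {v. \<exists>c :: nat list \<Rightarrow> int. v = (\<lambda>p. \<Sum>w\<in>Omega T. real_of_int (c w) * col w p)}"

definition coneA :: "nat \<Rightarrow> ((nat \<times> nat) \<Rightarrow> real) set" where
  "coneA T = {v. \<exists>c :: nat list \<Rightarrow> real. (\<forall>w. 0 \<le> c w) \<and>
                   v = (\<lambda>p. \<Sum>w\<in>Omega T. c w * col w p)}"

end

theory Submission
  imports Defs "HOL-Library.Product_Plus"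
begin

text \<open>
  Put \<open>N = T - 1\<close>. By Euler's theorem the columns are exactly the edge multisets of size \<open>N\<close>
  on three vertices whose net outflows lie in \<open>{-1,0,1}\<close>, and such a multiset of size \<open>z N\<close> is a
  long walk that can be cut into \<open>z\<close> columns. Up to the symmetries of the triangle and reversal, a
  vector of \<open>ZA \<inter> coneA\<close> with entry sum \<open>k N\<close> consists of \<open>A\<close> paths from 1 to 2, \<open>B\<close> paths from 1
  to 3 (each with one or two edges), two-cycles and triangles. Filling a path up to length \<open>N\<close> needs
  at least a certain number of two-cycles, depending on \<open>N\<close> modulo 3, and of triangles, depending on
  \<open>N\<close> modulo 2; all further filling is done in units of six edges (three two-cycles or two
  triangles), so only these minimal demands matter. Choosing how many paths have two edges and
  how many triangles of each orientation occur is a linear system with a totally unimodular matrix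
  whose right-hand sides are integers by the congruence \<open>k N = entry sum\<close>; hence it is
  solvable in integers as soon as the linear inequalities valid for all columns hold.
\<close>

section \<open>Walks and Eulerian edge vectors\<close>

text \<open>Edge multiplicities in the order 12, 13, 21, 23, 31, 32.\<close>
type_synonym vec = "nat \<times> nat \<times> nat \<times> nat \<times> nat \<times> nat"

definition steps :: "vec \<Rightarrow> nat" where
  "steps = (\<lambda>(a, b, c, d, e, f). a + b + c + d + e + f)"

definition outflow1 :: "vec \<Rightarrow> int" where
  "outflow1 = (\<lambda>(a, b, c, d, e, f). int a + int b - int c - int e)"

definition outflow2 :: "vec \<Rightarrow> int" where
  "outflow2 = (\<lambda>(a, b, c, d, e, f). int c + int d - int a - int f)"

definition outflow3 :: "vec \<Rightarrow> int" where
  "outflow3 = (\<lambda>(a, b, c, d, e, f). int e + int f - int b - int d)"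

lemmas vec_defs = steps_def outflow1_def outflow2_def outflow3_def

text \<open>The three net outflows add up to zero, so the bounds leave two cases: all vanish (closed
  trail), or there is one source and one sink (open trail).\<close>

definition eulerian :: "vec \<Rightarrow> bool" where
  "eulerian x \<longleftrightarrow> \<bar>outflow1 x\<bar> \<le> 1 \<and> \<bar>outflow2 x\<bar> \<le> 1 \<and> \<bar>outflow3 x\<bar> \<le> 1"

definition counts :: "nat list \<Rightarrow> vec" where
  "counts w = (xcount (1,2) w, xcount (1,3) w, xcount (2,1) w,
               xcount (2,3) w, xcount (3,1) w, xcount (3,2) w)"

definition walk :: "nat list \<Rightarrow> bool" where
  "walk w \<longleftrightarrow> w \<noteq> [] \<and> set w \<subseteq> {1,2,3} \<and> successively (\<noteq>) w"

lemma xcount_single [simp]: "xcount p [a] = 0"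
  by (simp add: xcount_def)

lemma xcount_Cons_Cons:
  "xcount p (a # b # w) = (if p = (a, b) then 1 else 0) + xcount p (b # w)"
proof -
  let ?S = "\<lambda>v. {l. Suc l < length v \<and> v ! l = fst p \<and> v ! Suc l = snd p}"
  have fin: "finite (?S (b # w))"
    by (rule finite_subset[of _ "{..<length (b # w)}"]) auto
  have "?S (a # b # w) = (if p = (a, b) then {0} else {}) \<union> Suc ` ?S (b # w)"
    by (rule set_eqI, rename_tac l, case_tac l) (auto simp: prod_eq_iff image_iff)
  then show ?thesis
    using fin by (auto simp: xcount_def card_image card_Un_disjoint)
qed

text \<open>The cut letter \<open>a\<close> ends the first piece and starts the second, so each
  adjacent pair lies in exactly one piece.\<close>

lemma xcount_append: "xcount p (u @ a # v) = xcount p (u @ [a]) + xcount p (a # v)"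
proof (induction u)
  case (Cons b u)
  then show ?case by (cases u) (auto simp: xcount_Cons_Cons)
qed simp

lemma counts_single [simp]: "counts [a] = 0"
  by (simp add: counts_def zero_prod_def)

lemma counts_append: "counts (u @ a # v) = counts (u @ [a]) + counts (a # v)"
  using xcount_append[of _ u a v] by (simp add: counts_def)

lemma steps_add [simp]: "steps (x + y) = steps x + steps y"
  by (simp add: vec_defs split: prod.splits)

lemma outflow_add [simp]:
  "outflow1 (x + y) = outflow1 x + outflow1 y"
  "outflow2 (x + y) = outflow2 x + outflow2 y"
  "outflow3 (x + y) = outflow3 x + outflow3 y"
  by (simp_all add: vec_defs split: prod.splits)

lemma edge_values:
  "steps (a, b, c, d, e, f) = a + b + c + d + e + f"
  "outflow1 (a, b, c, d, e, f) = int a + int b - int c - int e"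
  "outflow2 (a, b, c, d, e, f) = int c + int d - int a - int f"
  "outflow3 (a, b, c, d, e, f) = int e + int f - int b - int d"
  by (simp_all add: vec_defs)

text \<open>Each interior visit to a letter enters and leaves it once and cancels; only the two ends
  of the walk contribute to the net outflow.\<close>

lemma walk_counts:
  assumes "walk w"
  shows "steps (counts w) = length w - 1"
    and "outflow1 (counts w) = of_bool (hd w = 1) - of_bool (last w = 1)"
    and "outflow2 (counts w) = of_bool (hd w = 2) - of_bool (last w = 2)"
    and "outflow3 (counts w) = of_bool (hd w = 3) - of_bool (last w = 3)"
proof -
  have "steps (counts w) = length w - 1 \<and>
    outflow1 (counts w) = of_bool (hd w = 1) - of_bool (last w = 1) \<and>
    outflow2 (counts w) = of_bool (hd w = 2) - of_bool (last w = 2) \<and>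
    outflow3 (counts w) = of_bool (hd w = 3) - of_bool (last w = 3)"
    using assms
  proof (induction w rule: induct_list012)
    case (3 a b w)
    then have "walk (b # w)" "a \<in> {1,2,3}" "b \<in> {1,2,3}" "a \<noteq> b"
      by (auto simp: walk_def)
    moreover have "counts (a # b # w) = counts [a, b] + counts (b # w)"
      using counts_append[of "[a]" b w] by simp
    ultimately show ?case
      using "3.IH"(2) by (auto simp: counts_def[of "[_, _]"] xcount_Cons_Cons edge_values)
  qed (auto simp: walk_def counts_def vec_defs)
  then show "steps (counts w) = length w - 1"
    and "outflow1 (counts w) = of_bool (hd w = 1) - of_bool (last w = 1)"
    and "outflow2 (counts w) = of_bool (hd w = 2) - of_bool (last w = 2)"
    and "outflow3 (counts w) = of_bool (hd w = 3) - of_bool (last w = 3)"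
    by blast+
qed

lemma eulerian_counts: "walk w \<Longrightarrow> eulerian (counts w)"
  by (simp add: eulerian_def walk_counts(2-4))

section \<open>Inserting closed walks\<close>

lemma walk_insert:
  assumes "walk w" "a \<in> set w" "walk (a # v @ [a])"
  obtains w' where "walk w'" "counts w' = counts w + counts (a # v @ [a])"
proof -
  from assms(2) obtain s t where w: "w = s @ a # t" by (meson split_list)
  have "walk (s @ a # v @ a # t)"
    using assms unfolding w walk_def
    by (auto simp: successively_append_iff successively_Cons hd_append split: if_splits)
  moreover have "counts (s @ a # v @ a # t) = counts w + counts (a # v @ [a])"
    using counts_append[of s a t] counts_append[of s a "v @ a # t"] counts_append[of "a # v" a t]
    by (simp add: w ac_simps)
  ultimately show thesis using that by blast
qed

abbreviation "cycle12 \<equiv> (1, 0, 1, 0, 0, 0) :: vec"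
abbreviation "cycle13 \<equiv> (0, 1, 0, 0, 1, 0) :: vec"
abbreviation "cycle23 \<equiv> (0, 0, 0, 1, 0, 1) :: vec"
abbreviation "triangleF \<equiv> (1, 0, 0, 1, 1, 0) :: vec"
abbreviation "triangleR \<equiv> (0, 1, 1, 0, 0, 1) :: vec"

text \<open>A walk with an edge starts with two different letters, and any two 2-element subsets of
  {1,2,3} meet.\<close>

lemma walk_two_letters:
  assumes "walk w" "counts w \<noteq> 0" "a \<in> {1,2,3}" "b \<in> {1,2,3}" "a \<noteq> b"
  shows "a \<in> set w \<or> b \<in> set w"
proof -
  obtain c u where "w = c # u" using assms(1) by (auto simp: walk_def neq_Nil_conv)
  moreover from this obtain d v where "u = d # v" using assms(2) by (cases u) auto
  ultimately have "w = c # d # v" by simp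
  then show ?thesis using assms by (auto simp: walk_def)
qed

lemma walk_two_cycle:
  assumes "walk w" "a \<in> {1,2,3}" "b \<in> {1,2,3}" "a \<noteq> b"
  shows "\<exists>w'. walk w' \<and> counts w' = counts w + counts [a, b, a]"
proof -
  have ab: "counts [b, a, b] = counts [a, b, a]"
    using assms by (auto simp: counts_def xcount_Cons_Cons)
  have wab: "walk (a # [b] @ [a])" "walk (b # [a] @ [b])"
    using assms by (auto simp: walk_def)
  consider "a \<in> set w" | "b \<in> set w" | "counts w = 0"
    using walk_two_letters assms by blast
  then show ?thesis
  proof cases
    case 1
    then show ?thesis using walk_insert[OF assms(1) 1 wab(1)] by (metis append_Cons append_Nil)
  next
    case 2
    then show ?thesis using walk_insert[OF assms(1) 2 wab(2)] ab by (metis append_Cons append_Nil)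
  next
    \<comment> \<open>Without edges the walk is a single letter, possibly neither \<open>a\<close>
      nor \<open>b\<close>; the two-cycle itself replaces it.\<close>
    case 3
    then show ?thesis using wab by (intro exI[of _ "[a, b, a]"]) auto
  qed
qed

lemma walk_triangle:
  assumes "walk w" "x \<in> {triangleF, triangleR}"
  shows "\<exists>w'. walk w' \<and> counts w' = counts w + x"
proof -
  obtain a t where w: "w = a # t" "a \<in> {1,2,3}"
    using assms(1) by (cases w) (auto simp: walk_def)
  \<comment> \<open>A triangle passes through every letter, so it can be rotated to start at the
    first letter of the walk and inserted there.\<close>
  obtain v where "walk (a # v @ [a])" "counts (a # v @ [a]) = x"
  proof (cases "x = triangleF")
    case True
    show ?thesis
      by (rule that[of "if a = 1 then [2,3] else if a = 2 then [3,1] else [1,2]"])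
        (use w True in \<open>auto simp: walk_def counts_def xcount_Cons_Cons\<close>)
  next
    case False
    show ?thesis
      by (rule that[of "if a = 1 then [3,2] else if a = 2 then [1,3] else [2,1]"])
        (use w False assms in \<open>auto simp: walk_def counts_def xcount_Cons_Cons\<close>)
  qed
  then show ?thesis using walk_insert[OF assms(1), of a v] w by (metis list.set_intros(1))
qed

text \<open>Without directed cycles and with net outflows at most 1 in absolute value, only a simple
  path remains: the empty one, six single edges or six paths with two edges.\<close>

lemma eulerian_acyclic:
  assumes "eulerian (a, b, c, d, e, f)"
    and "a = 0 \<or> c = 0" "b = 0 \<or> e = 0" "d = 0 \<or> f = 0"
    and "a = 0 \<or> d = 0 \<or> e = 0" "b = 0 \<or> c = 0 \<or> f = 0"
  obtains w where "walk w" "counts w = (a, b, c, d, e, f)"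
proof -
  let ?W = "[[1],[1,2],[1,3],[2,1],[2,3],[3,1],[3,2],[1,2,3],[1,3,2],[2,1,3],[2,3,1],[3,1,2],[3,2,1]] :: nat list list"
  have "\<forall>w\<in>set ?W. walk w" by (auto simp: walk_def)
  moreover have "(a, b, c, d, e, f) \<in> set (map counts ?W)"
  proof -
    have "a \<le> 1" "b \<le> 1" "c \<le> 1" "d \<le> 1" "e \<le> 1" "f \<le> 1"
      using assms by (auto simp: eulerian_def vec_defs)
    then have "a \<in> {0,1}" "b \<in> {0,1}" "c \<in> {0,1}" "d \<in> {0,1}" "e \<in> {0,1}" "f \<in> {0,1}"
      by auto
    then have "(a, b, c, d, e, f) \<in> set
      [(0,0,0,0,0,0), (1,0,0,0,0,0), (0,1,0,0,0,0), (0,0,1,0,0,0), (0,0,0,1,0,0), (0,0,0,0,1,0),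
       (0,0,0,0,0,1), (1,0,0,1,0,0), (0,1,0,0,0,1), (0,1,1,0,0,0), (0,0,0,1,1,0), (1,0,0,0,1,0),
       (0,0,1,0,0,1)]"
      using assms(1)[unfolded eulerian_def edge_values] assms(2-) by (elim insertE emptyE; simp)
    also have "\<dots> = set (map counts ?W)"
      by (simp add: counts_def xcount_Cons_Cons)
    finally show ?thesis .
  qed
  ultimately show thesis using that by auto
qed

text \<open>Euler's theorem; connectivity is automatic since any two edges of a triangle meet.\<close>
lemma eulerian_walk:
  assumes "eulerian x"
  obtains w where "walk w" "counts w = x"
  using assms
proof (induction "steps x" arbitrary: x thesis rule: less_induct)
  case less
  obtain a b c d e f where x: "x = (a, b, c, d, e, f)" by (cases x)
  \<comment> \<open>Removing a closed piece \<open>z\<close> keeps the outflows and lowers the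
    number of edges; after the induction hypothesis, \<open>z\<close> is inserted back.\<close>
  have step: thesis if "steps x = steps y + steps z" "x = y + z" "outflow1 z = 0" "outflow2 z = 0" "outflow3 z = 0"
      "steps z > 0" and
      ins: "\<And>w. walk w \<Longrightarrow> \<exists>w'. walk w' \<and> counts w' = counts w + z" for y z
  proof -
    have "eulerian y" using less.prems(2) that by (simp add: eulerian_def)
    moreover have "steps y < steps x" using that by simp
    ultimately obtain w where "walk w" "counts w = y" using less.hyps by blast
    then show thesis using ins less.prems(1) that(2) by blast
  qed
  have cyc: "counts [1,2,1] = cycle12" "counts [1,3,1] = cycle13" "counts [2,3,2] = cycle23"
    by (auto simp: counts_def xcount_Cons_Cons)
  have two: "\<exists>w'. walk w' \<and> counts w' = counts w + cycle12"
    "\<exists>w'. walk w' \<and> counts w' = counts w + cycle13"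
    "\<exists>w'. walk w' \<and> counts w' = counts w + cycle23" if "walk w" for w
    using walk_two_cycle[OF that, of 1 2, unfolded cyc] walk_two_cycle[OF that, of 1 3, unfolded cyc]
      walk_two_cycle[OF that, of 2 3, unfolded cyc] by simp_all
  have tri: "\<exists>w'. walk w' \<and> counts w' = counts w + triangleF"
    "\<exists>w'. walk w' \<and> counts w' = counts w + triangleR" if "walk w" for w
    using walk_triangle[OF that, of triangleF] walk_triangle[OF that, of triangleR] by simp_all
  consider "a > 0 \<and> c > 0" | "b > 0 \<and> e > 0" | "d > 0 \<and> f > 0" | "a > 0 \<and> d > 0 \<and> e > 0"
    | "b > 0 \<and> c > 0 \<and> f > 0"
    | "(a = 0 \<or> c = 0) \<and> (b = 0 \<or> e = 0) \<and> (d = 0 \<or> f = 0) \<and>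
       (a = 0 \<or> d = 0 \<or> e = 0) \<and> (b = 0 \<or> c = 0 \<or> f = 0)" by linarith
  then show ?case
  proof cases
    case 1
    show ?thesis
      by (rule step[OF _ _ _ _ _ _ two(1), of "(a - 1, b, c - 1, d, e, f)"])
        (use 1 in \<open>auto simp: x edge_values\<close>)
  next
    case 2
    show ?thesis
      by (rule step[OF _ _ _ _ _ _ two(2), of "(a, b - 1, c, d, e - 1, f)"])
        (use 2 in \<open>auto simp: x edge_values\<close>)
  next
    case 3
    show ?thesis
      by (rule step[OF _ _ _ _ _ _ two(3), of "(a, b, c, d - 1, e, f - 1)"])
        (use 3 in \<open>auto simp: x edge_values\<close>)
  next
    case 4
    show ?thesis
      by (rule step[OF _ _ _ _ _ _ tri(1), of "(a - 1, b, c, d - 1, e - 1, f)"])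
        (use 4 in \<open>auto simp: x edge_values\<close>)
  next
    case 5
    show ?thesis
      by (rule step[OF _ _ _ _ _ _ tri(2), of "(a, b - 1, c - 1, d, e, f - 1)"])
        (use 5 in \<open>auto simp: x edge_values\<close>)
  next
    case 6
    show ?thesis
      by (rule eulerian_acyclic[of a b c d e f])
        (use 6 less.prems in \<open>auto simp: x\<close>)
  qed
qed

section \<open>Filling paths with cycles\<close>

text \<open>Words of length \<open>N + 1\<close> have \<open>N\<close> edges, so by
  \<open>eulerian_walk\<close> the summands are exactly columns: this is membership in the semigroup
  with \<open>k\<close> generators.\<close>

definition decomposable :: "nat \<Rightarrow> nat \<Rightarrow> vec \<Rightarrow> bool" where
  "decomposable N k v \<longleftrightarrow>
     (\<exists>xs. length xs = k \<and> sum_list xs = v \<and> (\<forall>x\<in>set xs. eulerian x \<and> steps x = N))"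

lemma decomposable_0: "decomposable N 0 0"
  by (simp add: decomposable_def)

lemma decomposable_add:
  assumes "decomposable N k u" "decomposable N l v"
  shows "decomposable N (k + l) (u + v)"
proof -
  obtain xs ys where "length xs = k" "sum_list xs = u" "\<forall>x\<in>set xs. eulerian x \<and> steps x = N"
    "length ys = l" "sum_list ys = v" "\<forall>x\<in>set ys. eulerian x \<and> steps x = N"
    using assms by (auto simp: decomposable_def)
  then show ?thesis unfolding decomposable_def
    by (intro exI[of _ "xs @ ys"]) auto
qed

lemma decomposable_cut:
  assumes "eulerian x" "steps x = k * N"
  shows "decomposable N k x"
  using assms
proof (induction k arbitrary: x)
  case 0
  then have "x = 0" by (cases x) (auto simp: vec_defs zero_prod_def)
  then show ?case by (simp add: decomposable_0)
next
  case (Suc k)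
  obtain w where w: "walk w" "counts w = x" using eulerian_walk Suc.prems(1) .
  have len: "length w = Suc (Suc k * N)"
    using walk_counts(1)[OF w(1)] w Suc.prems(2) by (cases w) (auto simp: walk_def)
  \<comment> \<open>The letter at position \<open>N\<close> is shared: \<open>s @ [a]\<close>
    carries the first \<open>N\<close> edges and \<open>a # t\<close> the other
    \<open>k * N\<close>.\<close>
  obtain s a t where st: "w = s @ a # t" "length s = N"
  proof
    show "w = take N w @ w ! N # drop (Suc N) w" by (rule id_take_nth_drop) (simp add: len)
  qed (simp add: len)
  have wk: "walk (s @ [a])" "walk (a # t)"
    using w(1) by (auto simp: walk_def st successively_append_iff)
  have "steps (counts (s @ [a])) = N" "steps (counts (a # t)) = k * N"
    using walk_counts(1)[OF wk(1)] walk_counts(1)[OF wk(2)] len st by auto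
  then have "decomposable N k (counts (a # t))" "decomposable N 1 (counts (s @ [a]))"
    using Suc.IH eulerian_counts wk
    by (auto simp: decomposable_def intro: exI[of _ "[counts (s @ [a])]"])
  from decomposable_add[OF this(2,1)] show ?case
    using counts_append[of s a t] w(2) st by simp
qed

section \<open>Symmetries: relabelling vertices and reversing edges\<close>

lemma decomposable_permute:
  assumes "decomposable N k v"
    and "h 0 = 0" "\<And>x y. h (x + y) = h x + h y"
    and "\<And>x. eulerian (h x) = eulerian x" "\<And>x. steps (h x) = steps x"
  shows "decomposable N k (h v)"
proof -
  obtain xs where xs: "length xs = k" "sum_list xs = v" "\<forall>x\<in>set xs. eulerian x \<and> steps x = N"
    using assms(1) by (auto simp: decomposable_def)
  have "sum_list (map h xs) = h (sum_list xs)"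
    by (induction xs) (simp_all add: assms)
  then show ?thesis
    using xs assms(4,5) unfolding decomposable_def by (intro exI[of _ "map h xs"]) auto
qed

lemma decomposable_swap12:
  "decomposable N k (c, d, a, b, f, e) \<Longrightarrow> decomposable N k (a, b, c, d, e, f)"
  by (drule decomposable_permute[of _ _ _ "\<lambda>(a, b, c, d, e, f). (c, d, a, b, f, e)"])
    (auto simp: eulerian_def edge_values zero_prod_def)

lemma decomposable_swap23:
  "decomposable N k (b, a, e, f, c, d) \<Longrightarrow> decomposable N k (a, b, c, d, e, f)"
  by (drule decomposable_permute[of _ _ _ "\<lambda>(a, b, c, d, e, f). (b, a, e, f, c, d)"])
    (auto simp: eulerian_def edge_values zero_prod_def)

lemma decomposable_reverse:
  "decomposable N k (c, e, a, f, b, d) \<Longrightarrow> decomposable N k (a, b, c, d, e, f)"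
  by (drule decomposable_permute[of _ _ _ "\<lambda>(a, b, c, d, e, f). (c, e, a, f, b, d)"])
    (auto simp: eulerian_def edge_values zero_prod_def)

text \<open>Here \<open>i\<close>, \<open>j\<close>, \<open>l\<close> count the two-cycles on 12, 13, 23, and \<open>f\<close>, \<open>r\<close> the triangles 1231 and 1321.\<close>
definition cycles :: "nat \<Rightarrow> nat \<Rightarrow> vec \<Rightarrow> bool" where
  "cycles p q x \<longleftrightarrow> (\<exists>i j l f r. p = i + j + l \<and> q = f + r \<and>
     x = (i + f, j + r, i + r, l + f, j + f, l + r))"

lemma cycles_steps: "cycles p q x \<Longrightarrow> steps x = 2 * p + 3 * q"
  by (auto simp: cycles_def edge_values)

lemma cycles_outflow:
  assumes "cycles p q x"
  shows "outflow1 x = 0" "outflow2 x = 0" "outflow3 x = 0"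
  using assms by (auto simp: cycles_def edge_values)

lemma cycles_split:
  assumes "cycles (p + p') (q + q') x"
  obtains y z where "x = y + z" "cycles p q y" "cycles p' q' z"
proof -
  obtain i j l f r where x: "p + p' = i + j + l" "q + q' = f + r"
    "x = (i + f, j + r, i + r, l + f, j + f, l + r)"
    using assms by (auto simp: cycles_def)
  \<comment> \<open>Greedy choice: as many cycles of the first kind as fit, then of the next, the
    last kind making up the rest.\<close>
  define i' j' f' where "i' = min i p" and "j' = min j (p - i')" and "f' = min f q"
  define l' r' where "l' = p - i' - j'" and "r' = q - f'"
  have le: "p = i' + j' + l'" "q = f' + r'" "i' \<le> i" "j' \<le> j" "l' \<le> l" "f' \<le> f" "r' \<le> r"
    using x(1,2) by (auto simp: i'_def j'_def f'_def l'_def r'_def)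
  show thesis
  proof
    show "x = (i' + f', j' + r', i' + r', l' + f', j' + f', l' + r') +
       ((i - i') + (f - f'), (j - j') + (r - r'), (i - i') + (r - r'),
        (l - l') + (f - f'), (j - j') + (f - f'), (l - l') + (r - r'))"
      using le by (simp add: x(3))
    show "cycles p q (i' + f', j' + r', i' + r', l' + f', j' + f', l' + r')"
      unfolding cycles_def using le by blast
    have "p' = (i - i') + (j - j') + (l - l')" "q' = (f - f') + (r - r')"
      using le x(1,2) by linarith+
    then show "cycles p' q' ((i - i') + (f - f'), (j - j') + (r - r'), (i - i') + (r - r'),
        (l - l') + (f - f'), (j - j') + (f - f'), (l - l') + (r - r'))"
      unfolding cycles_def by blast
  qed
qed

text \<open>\<open>2 * n mod 3\<close> and \<open>n mod 2\<close> are the least numbers of two-cycles and of triangles in a filling of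
  length \<open>n\<close>; the length 1 cannot be filled.\<close>
lemma min_cycles:
  assumes "n \<noteq> 1"
  shows "\<exists>s::nat. n = 2 * (2 * n mod 3) + 3 * (n mod 2) + 6 * s"
proof -
  define k where "k = n div 6"
  have "n mod 6 < 6" by simp
  then consider "n = 6 * k" | "n = 6 * k + 1" | "n = 6 * k + 2" | "n = 6 * k + 3"
    | "n = 6 * k + 4" | "n = 6 * k + 5"
    unfolding k_def by linarith
  then show ?thesis
  proof cases
    case 1 then have "2 * n mod 3 = 0" "n mod 2 = 0" by presburger+
    then show ?thesis using 1 by auto
  next
    \<comment> \<open>The least filling here uses 2 two-cycles and 1 triangle, that is 7 edges;
      \<open>n \<noteq> 1\<close> gives \<open>k \<ge> 1\<close>, and \<open>k - 1\<close> units of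
      six remain.\<close>
    case 2 then have "2 * n mod 3 = 2" "n mod 2 = 1" by presburger+
    then show ?thesis using 2 assms by (intro exI[of _ "k - 1"]) auto
  next
    case 3 then have "2 * n mod 3 = 1" "n mod 2 = 0" by presburger+
    then show ?thesis using 3 by auto
  next
    case 4 then have "2 * n mod 3 = 0" "n mod 2 = 1" by presburger+
    then show ?thesis using 4 by auto
  next
    case 5 then have "2 * n mod 3 = 2" "n mod 2 = 0" by presburger+
    then show ?thesis using 5 by auto
  next
    case 6 then have "2 * n mod 3 = 1" "n mod 2 = 1" by presburger+
    then show ?thesis using 6 by auto
  qed
qed

text \<open>An item \<open>(x, m)\<close> is a path \<open>x\<close> to be enlarged to a walk of
  \<open>m * N\<close> edges, later cut into \<open>m\<close> columns; the defect is the number of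
  edges that cycles must supply.\<close>

definition defect :: "nat \<Rightarrow> vec \<times> nat \<Rightarrow> nat" where
  "defect N = (\<lambda>(x, m). m * N - steps x)"

text \<open>The cycles left over after filling all items form one closed walk of length \<open>z * N\<close>, which is cut.\<close>
lemma decomposable_fill:
  assumes "\<forall>(x, m)\<in>set its. eulerian x \<and> steps x \<le> m * N \<and> defect N (x, m) \<noteq> 1"
    and "N \<ge> 2" "cycles p q c"
    and "(\<Sum>t\<leftarrow>its. 2 * defect N t mod 3) \<le> p" "(\<Sum>t\<leftarrow>its. defect N t mod 2) \<le> q"
    and "2 * p + 3 * q = (\<Sum>t\<leftarrow>its. defect N t) + z * N"
  shows "decomposable N (sum_list (map snd its) + z) (sum_list (map fst its) + c)"
  using assms
proof (induction its arbitrary: p q c)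
  case Nil
  then show ?case
    using cycles_outflow[of p q c] cycles_steps[of p q c]
    by (auto intro!: decomposable_cut simp: eulerian_def)
next
  case (Cons t its)
  obtain x m where t: "t = (x, m)" by (cases t)
  let ?n = "defect N t"
  let ?S = "\<lambda>g. \<Sum>t\<leftarrow>its. g (defect N t) :: nat"
  \<comment> \<open>Beyond the minimal demands, the items together need a whole number
    \<open>s'\<close> of six-edge units.\<close>
  have "\<exists>s'. (\<Sum>t\<leftarrow>ys. defect N t) = 2 * (\<Sum>t\<leftarrow>ys. 2 * defect N t mod 3)
      + 3 * (\<Sum>t\<leftarrow>ys. defect N t mod 2) + 6 * s'"
    if "\<forall>(x, m)\<in>set ys. defect N (x, m) \<noteq> 1" for ys
    using that
  proof (induction ys)
    case (Cons u ys)
    then obtain s' where s': "(\<Sum>t\<leftarrow>ys. defect N t) = 2 * (\<Sum>t\<leftarrow>ys. 2 * defect N t mod 3)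
      + 3 * (\<Sum>t\<leftarrow>ys. defect N t mod 2) + 6 * s'" by auto
    obtain s where "defect N u = 2 * (2 * defect N u mod 3) + 3 * (defect N u mod 2) + 6 * s"
      using min_cycles[of "defect N u"] Cons.prems by (cases u) auto
    then show ?case using s' by (intro exI[of _ "s + s'"]) simp
  qed simp
  then obtain s' where s': "?S (\<lambda>n. n) = 2 * ?S (\<lambda>n. 2 * n mod 3) + 3 * ?S (\<lambda>n. n mod 2) + 6 * s'"
    using Cons.prems(1) by fastforce
  obtain s where s: "?n = 2 * (2 * ?n mod 3) + 3 * (?n mod 2) + 6 * s"
    using min_cycles[of ?n] Cons.prems(1) t by auto
  \<comment> \<open>\<open>u\<close> and \<open>v\<close> are the two-cycles and triangles left once
    every item has received its minimal demand.\<close>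
  define u where "u = p - ?S (\<lambda>n. 2 * n mod 3) - 2 * ?n mod 3"
  define v where "v = q - ?S (\<lambda>n. n mod 2) - ?n mod 2"
  have p: "p = ?S (\<lambda>n. 2 * n mod 3) + 2 * ?n mod 3 + u"
    and q: "q = ?S (\<lambda>n. n mod 2) + ?n mod 2 + v"
    using Cons.prems(4,5) by (simp_all add: u_def v_def)
  have uv: "2 * u + 3 * v = 6 * s + 6 * s' + z * N"
    using Cons.prems(6) s s' p q by simp
  \<comment> \<open>\<open>N \<ge> 2\<close> excludes \<open>z * N = 1\<close>, the one value for
    which the counting argument below would fail.\<close>
  have zN: "z * N = 0 \<or> z * N \<ge> 2"
    using Cons.prems(2) by (cases z) auto
  \<comment> \<open>Of the \<open>s\<close> units for the first item, as many as possible are three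
    two-cycles. If these run out, fewer than three surplus two-cycles remain, and counting edges
    shows that the triangles suffice.\<close>
  define j where "j = min s (u div 3)"
  have j: "3 * j \<le> u" "2 * (s - j) \<le> v"
  proof -
    show "3 * j \<le> u" unfolding j_def by linarith
    show "2 * (s - j) \<le> v"
    proof (cases "s \<le> u div 3")
      case False
      then have "j = u div 3" by (simp add: j_def)
      define e where "e = s - j"
      have "s = j + e" "u = 3 * j + u mod 3" using \<open>j = u div 3\<close> False by (auto simp: e_def)
      then have eq: "2 * (u mod 3) + 3 * v = 6 * e + 6 * s' + z * N" using uv by linarith
      have "2 * e \<le> v"
      proof (rule ccontr)
        assume v: "\<not> 2 * e \<le> v"
        then obtain i where "2 * e = Suc (v + i)" using less_natE not_le by metis
        then have i: "2 * (u mod 3) = 3 + 3 * i + 6 * s' + z * N" using eq by linarith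
        moreover have "u mod 3 \<le> 2" by simp
        ultimately have "3 * i + 6 * s' + z * N \<le> 1" by linarith
        then have "i = 0" "s' = 0" "z * N = 0" using zN by linarith+
        then show False using i by presburger
      qed
      then show ?thesis by (simp add: e_def)
    qed (simp add: j_def)
  qed
  define a b where "a = 2 * ?n mod 3 + 3 * j" and "b = ?n mod 2 + 2 * (s - j)"
  have "j \<le> s" by (simp add: j_def)
  then have ab: "2 * a + 3 * b = ?n" using s by (simp add: a_def b_def)
  have le: "a + ?S (\<lambda>n. 2 * n mod 3) \<le> p" "b + ?S (\<lambda>n. n mod 2) \<le> q"
    using p q j by (simp_all add: a_def b_def)
  then have "cycles (a + (p - a)) (b + (q - b)) c" using Cons.prems(3) by simp
  then obtain y w where yw: "c = y + w" "cycles a b y" "cycles (p - a) (q - b) w"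
    by (rule cycles_split)
  have "decomposable N (sum_list (map snd its) + z) (sum_list (map fst its) + w)"
    by (rule Cons.IH[OF _ _ yw(3)]) (use Cons.prems le ab in auto)
  moreover have "decomposable N m (x + y)"
  proof (rule decomposable_cut)
    show "eulerian (x + y)"
      using Cons.prems(1) cycles_outflow[OF yw(2)] by (simp add: t eulerian_def)
    show "steps (x + y) = m * N"
      using Cons.prems(1) cycles_steps[OF yw(2)] ab by (simp add: t defect_def)
  qed
  ultimately have "decomposable N (m + (sum_list (map snd its) + z)) (x + y + (sum_list (map fst its) + w))"
    by (rule decomposable_add[rotated])
  then show ?case
    by (simp add: t yw(1) ac_simps)
qed

section \<open>The integer system\<close>

text \<open>In the variables \<open>-x\<close>, \<open>r\<close>, \<open>-y\<close> the constraint matrix has consecutive ones, so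
  Fourier--Motzkin elimination stays integral.\<close>
lemma interval_system_solvable:
  fixes A B c e d \<alpha> LE UE LG UG :: int
  assumes "\<And>l u. l \<in> {LE, - A, - \<alpha>, LG - A, - \<alpha> - UG, LG - A - UG} \<Longrightarrow>
      u \<in> {UE, d - \<alpha>, c, e - \<alpha> + B, UG + B, e - \<alpha> - LG + c, UG - LG + c} \<Longrightarrow> l \<le> u"
    and "\<And>l u. l \<in> {- \<alpha>, LG - A} \<Longrightarrow> u \<in> {e - \<alpha>, UG} \<Longrightarrow> l \<le> u"
    and "0 \<le> A" "0 \<le> B" "0 \<le> c" "- B \<le> UG" "LG \<le> c" "LG \<le> UG"
  obtains x y r where "0 \<le> x" "x \<le> A" "0 \<le> y" "y \<le> B" "0 \<le> r" "r \<le> c"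
    "0 \<le> r + \<alpha> - x - y" "r + \<alpha> - x - y \<le> e" "r + \<alpha> - x \<le> d"
    "LE \<le> r - x" "r - x \<le> UE" "LG \<le> r - y" "r - y \<le> UG"
proof -
  have ex: "\<exists>t. (\<forall>l\<in>L. l \<le> t) \<and> (\<forall>u\<in>U. t \<le> u)"
    if "finite L" "L \<noteq> {}" "\<forall>l\<in>L. \<forall>u\<in>U. l \<le> u" for L U :: "int set"
    using that by (intro exI[of _ "Max L"]) auto
  \<comment> \<open>The unknowns are the partial sums \<open>n1 = - x\<close>,
    \<open>n2 = r - x\<close>, \<open>n3 = r - x - y\<close>; every condition bounds one of them or
    a difference of two. Eliminating \<open>n1\<close>, then \<open>n3\<close>, leaves the listed
    bounds on \<open>n2\<close>; the choices are made in the opposite order.\<close>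
  obtain n2 where n2: "\<forall>l\<in>{LE, - A, - \<alpha>, LG - A, - \<alpha> - UG, LG - A - UG}. l \<le> n2"
    "\<forall>u\<in>{UE, d - \<alpha>, c, e - \<alpha> + B, UG + B, e - \<alpha> - LG + c, UG - LG + c}. n2 \<le> u"
    using ex[of "{LE, - A, - \<alpha>, LG - A, - \<alpha> - UG, LG - A - UG}"
        "{UE, d - \<alpha>, c, e - \<alpha> + B, UG + B, e - \<alpha> - LG + c, UG - LG + c}"] assms(1) by blast
  have "\<exists>n3. (\<forall>l\<in>{- \<alpha>, LG - A, n2 - B, n2 + LG - c}. l \<le> n3) \<and>
      (\<forall>u\<in>{e - \<alpha>, UG, n2, n2 + UG}. n3 \<le> u)"
    using n2 assms(2-) by (intro ex) auto
  then obtain n3 where n3: "\<forall>l\<in>{- \<alpha>, LG - A, n2 - B, n2 + LG - c}. l \<le> n3"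
    "\<forall>u\<in>{e - \<alpha>, UG, n2, n2 + UG}. n3 \<le> u" by blast
  have "\<exists>n1. (\<forall>l\<in>{- A, n2 - c, n3 - UG}. l \<le> n1) \<and> (\<forall>u\<in>{0, n2, n3 - LG}. n1 \<le> u)"
    using n2 n3 assms(3-) by (intro ex) auto
  then obtain n1 where n1: "\<forall>l\<in>{- A, n2 - c, n3 - UG}. l \<le> n1" "\<forall>u\<in>{0, n2, n3 - LG}. n1 \<le> u"
    by blast
  show thesis
    by (rule that[of "- n1" "n2 - n3" "n2 - n1"]) (use n1 n2 n3 in auto)
qed

section \<open>Budgets of cycles for paths with one or two edges\<close>

lemma sum_list_replicate_vec:
  "sum_list (replicate n (a, b, c, d, e, f)) = (n * a, n * b, n * c, n * d, n * e, n * f :: nat)"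
  by (induction n) (auto simp: zero_prod_def)

text \<open>\<open>s\<close>, \<open>w\<close>, \<open>y\<close>, \<open>t\<close> count the paths 12, 13, 123, 132; index 2 marks walks of double length.\<close>
lemma decomposable_pieces:
  assumes "N \<ge> 2" "cycles p q c"
    and "N = 2 \<Longrightarrow> s1 = 0 \<and> w1 = 0" "N = 3 \<Longrightarrow> t1 = 0 \<and> y1 = 0"
    and "(s1 + w1) * (2 * (N - 1) mod 3) + (s2 + w2) * (2 * (2 * N - 1) mod 3)
       + (t1 + y1) * (2 * (N - 2) mod 3) + (t2 + y2) * (2 * (2 * N - 2) mod 3) \<le> p"
    and "(s1 + w1) * ((N - 1) mod 2) + (s2 + w2) * ((2 * N - 1) mod 2)
       + (t1 + y1) * ((N - 2) mod 2) + (t2 + y2) * ((2 * N - 2) mod 2) \<le> q"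
    and "s1 + w1 + s2 + w2 + 2 * (t1 + y1 + t2 + y2) + 2 * p + 3 * q = k * N"
    and "s1 + w1 + 2 * (s2 + w2) + t1 + y1 + 2 * (t2 + y2) \<le> k"
  shows "decomposable N k ((s1 + s2 + y1 + y2, t1 + t2 + w1 + w2, 0, y1 + y2, 0, t1 + t2) + c)"
proof -
  let ?s = "(1, 0, 0, 0, 0, 0) :: vec" and ?w = "(0, 1, 0, 0, 0, 0) :: vec"
  let ?t = "(0, 1, 0, 0, 0, 1) :: vec" and ?y = "(1, 0, 0, 1, 0, 0) :: vec"
  define its where "its = replicate s1 (?s, 1::nat) @ replicate s2 (?s, 2) @
    replicate w1 (?w, 1) @ replicate w2 (?w, 2) @ replicate t1 (?t, 1) @ replicate t2 (?t, 2) @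
    replicate y1 (?y, 1) @ replicate y2 (?y, 2)"
  \<comment> \<open>\<open>z\<close> is the number of columns to be cut from the leftover
    cycles.\<close>
  define z where "z = k - (s1 + w1 + 2 * (s2 + w2) + t1 + y1 + 2 * (t2 + y2))"
  have k: "k = s1 + w1 + 2 * (s2 + w2) + t1 + y1 + 2 * (t2 + y2) + z"
    using assms(8) by (simp add: z_def)
  have defect: "defect N (?s, 1) = N - 1" "defect N (?s, 2) = 2 * N - 1"
    "defect N (?w, 1) = N - 1" "defect N (?w, 2) = 2 * N - 1"
    "defect N (?t, 1) = N - 2" "defect N (?t, 2) = 2 * N - 2"
    "defect N (?y, 1) = N - 2" "defect N (?y, 2) = 2 * N - 2"
    by (simp_all add: defect_def edge_values numeral_2_eq_2)
  obtain M where M: "N = M + 2" using assms(1) by (metis add.commute le_Suc_ex)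
  have "decomposable N (sum_list (map snd its) + z) (sum_list (map fst its) + c)"
  proof (rule decomposable_fill[OF _ assms(1,2)])
    \<comment> \<open>Defect 1 could only come from a one-edge path with \<open>N = 2\<close> or a
      two-edge path with \<open>N = 3\<close>, both at single length; the hypotheses rule these
      out.\<close>
    show "\<forall>(x, m)\<in>set its. eulerian x \<and> steps x \<le> m * N \<and> defect N (x, m) \<noteq> 1"
      using assms(3,4) by (auto simp: its_def defect_def eulerian_def edge_values M)
    show "(\<Sum>t\<leftarrow>its. 2 * defect N t mod 3) \<le> p" "(\<Sum>t\<leftarrow>its. defect N t mod 2) \<le> q"
      using assms(5,6) by (simp_all add: its_def sum_list_replicate defect[simplified] algebra_simps)
    show "2 * p + 3 * q = (\<Sum>t\<leftarrow>its. defect N t) + z * N"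
      using assms(7) unfolding k
      by (simp add: its_def sum_list_replicate defect_def edge_values M algebra_simps)
  qed
  then show ?thesis
    by (simp add: its_def sum_list_replicate sum_list_replicate_vec k algebra_simps)
qed

lemma split_le_add:
  fixes i s w :: nat
  assumes "i \<le> s + w"
  shows "\<exists>s1 s2 w1 w2. s = s1 + s2 \<and> w = w1 + w2 \<and> i = s2 + w2"
proof (cases "i \<le> s")
  case True
  then show ?thesis by (intro exI[of _ "s - i"] exI[of _ i] exI[of _ w] exI[of _ 0]) simp
next
  case False
  then show ?thesis
    using assms by (intro exI[of _ 0] exI[of _ s] exI[of _ "w - (i - s)"] exI[of _ "i - s"]) simp
qed

lemma mod_shift:
  fixes c n :: nat
  shows "2 * (6 * n + c) mod 3 = 2 * c mod 3" "(6 * n + c) mod 2 = c mod 2"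
    "2 * (12 * n + c) mod 3 = 2 * c mod 3" "(12 * n + c) mod 2 = c mod 2"
    "(6 * n + c) mod 3 = c mod 3"
proof -
  have "2 * (6 * n + c) = 2 * c + 3 * (4 * n)" "2 * (12 * n + c) = 2 * c + 3 * (8 * n)"
    "6 * n + c = c + 2 * (3 * n)" "12 * n + c = c + 2 * (6 * n)" by simp_all
  then show "2 * (6 * n + c) mod 3 = 2 * c mod 3" "(6 * n + c) mod 2 = c mod 2"
    "2 * (12 * n + c) mod 3 = 2 * c mod 3" "(12 * n + c) mod 2 = c mod 2"
    by (simp_all only: mod_mult_self2)
  have "6 * n + c = c + 3 * (2 * n)" by simp
  then show "(6 * n + c) mod 3 = c mod 3" by (simp only: mod_mult_self2)
qed

text \<open>Spare copies of \<open>N\<close> (there are \<open>k - S1 - S2\<close>) are spent on doubling the target length of those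
  paths for which this lowers the demand for cycles; this is where \<open>k\<close> enters the budgets.\<close>
lemma decomposable_budget:
  assumes N: "N \<ge> 2" and c: "cycles p q c"
    and S: "S1 = s + w" "S2 = t + y" "S1 + S2 \<le> k"
    and size: "S1 + 2 * S2 + 2 * p + 3 * q = k * N"
    and even: "even N \<Longrightarrow> S1 \<le> q" and odd: "odd N \<Longrightarrow> S1 + 2 * S2 \<le> q + k"
    and mod0: "N mod 3 = 0 \<Longrightarrow> S1 + 2 * S2 \<le> p"
    and mod1: "N mod 3 = 1 \<Longrightarrow> S1 + 2 * S2 \<le> p + k"
    and mod2: "N mod 3 = 2 \<Longrightarrow> 4 * S1 + 2 * S2 \<le> p + 2 * k"
  shows "decomposable N k ((s + y, t + w, 0, y, 0, t) + c)"
proof -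
  \<comment> \<open>Doubling the target of \<open>i\<close> one-edge and \<open>j\<close> two-edge
    paths changes their demands; it remains to choose \<open>i\<close> and \<open>j\<close> for each
    residue of \<open>N\<close> modulo 6.\<close>
  have double: "decomposable N k ((s + y, t + w, 0, y, 0, t) + c)" if ij: "i \<le> S1" "j \<le> S2" "S1 + i + S2 + j \<le> k"
    and small: "N = 2 \<Longrightarrow> i = S1" "N = 3 \<Longrightarrow> j = S2"
    and budget: "(S1 - i) * (2 * (N - 1) mod 3) + i * (2 * (2 * N - 1) mod 3)
        + (S2 - j) * (2 * (N - 2) mod 3) + j * (2 * (2 * N - 2) mod 3) \<le> p"
      "(S1 - i) * ((N - 1) mod 2) + i * ((2 * N - 1) mod 2)
        + (S2 - j) * ((N - 2) mod 2) + j * ((2 * N - 2) mod 2) \<le> q"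
    for i j
  proof -
    obtain s1 s2 w1 w2 where 1: "s = s1 + s2" "w = w1 + w2" "i = s2 + w2"
      using split_le_add ij(1) S(1) by blast
    obtain t1 t2 y1 y2 where 2: "t = t1 + t2" "y = y1 + y2" "j = t2 + y2"
      using split_le_add ij(2) S(2) by blast
    have sub: "S1 - i = s1 + w1" "S2 - j = t1 + y1" by (simp_all add: S 1 2)
    have "decomposable N k ((s1 + s2 + y1 + y2, t1 + t2 + w1 + w2, 0, y1 + y2, 0, t1 + t2) + c)"
    proof (rule decomposable_pieces[OF N c])
      show "s1 = 0 \<and> w1 = 0" if "N = 2" using small(1)[OF that] sub(1) by simp
      show "t1 = 0 \<and> y1 = 0" if "N = 3" using small(2)[OF that] sub(2) by simp
    qed (use budget[unfolded sub 1(3) 2(3)] ij(3) size in \<open>simp_all add: S 1 2\<close>)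
    then show ?thesis by (simp only: 1 2 add.assoc)
  qed
  \<comment> \<open>Since \<open>N \<ge> 2\<close>, the residues 0 and 1 modulo 6 start at 6 and
    7.\<close>
  define n where "n = (N - 2) div 6"
  have "N = 6 * n + ((N - 2) mod 6 + 2)" "(N - 2) mod 6 < 6"
    using N by (simp_all add: n_def)
  then consider "N = 6 * n + 6" | "N = 6 * n + 7" | "N = 6 * n + 2" | "N = 6 * n + 3"
    | "N = 6 * n + 4" | "N = 6 * n + 5" by linarith
  then show ?thesis
  proof cases
    case 1
    have sub: "N - Suc 0 = 6 * n + 5" "N - 2 = 6 * n + 4"
      "2 * N - Suc 0 = 12 * n + 11" "2 * N - 2 = 12 * n + 10"
      using 1 by simp_all
    have ne: "N \<noteq> 2" "N \<noteq> 3"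
      using 1 by simp_all
    have N_mod: "N mod 3 = 0" "even N"
      unfolding 1 even_iff_mod_2_eq_zero odd_iff_mod_2_eq_one mod_shift by simp_all
    have mods: "2 * (N - Suc 0) mod 3 = 1" "2 * (N - 2) mod 3 = 2"
      "(N - Suc 0) mod 2 = 1" "(N - 2) mod 2 = 0"
      "2 * (2 * N - Suc 0) mod 3 = 1" "2 * (2 * N - 2) mod 3 = 2"
      "(2 * N - Suc 0) mod 2 = 1" "(2 * N - 2) mod 2 = 0"
      unfolding sub mod_shift by simp_all
    \<comment> \<open>Doubling changes neither demand here, so no path is doubled.\<close>
    show ?thesis
      by (rule double[of 0 0])
        (use even[OF N_mod(2)] mod0[OF N_mod(1)] S(3) ne in \<open>simp_all add: mods\<close>)
  next
    case 2
    have sub: "N - Suc 0 = 6 * n + 6" "N - 2 = 6 * n + 5"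
      "2 * N - Suc 0 = 12 * n + 13" "2 * N - 2 = 12 * n + 12"
      using 2 by simp_all
    have ne: "N \<noteq> 2" "N \<noteq> 3"
      using 2 by simp_all
    have N_mod: "N mod 3 = 1" "odd N"
      unfolding 2 even_iff_mod_2_eq_zero odd_iff_mod_2_eq_one mod_shift by simp_all
    have mods: "2 * (N - Suc 0) mod 3 = 0" "2 * (N - 2) mod 3 = 1"
      "(N - Suc 0) mod 2 = 0" "(N - 2) mod 2 = 1"
      "2 * (2 * N - Suc 0) mod 3 = 2" "2 * (2 * N - 2) mod 3 = 0"
      "(2 * N - Suc 0) mod 2 = 1" "(2 * N - 2) mod 2 = 0"
      unfolding sub mod_shift by simp_all
    \<comment> \<open>Doubling a two-edge path saves one two-cycle and one triangle, so all spare
      copies go there.\<close>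
    show ?thesis
      by (rule double[of 0 "min S2 (k - S1 - S2)"])
        (use odd[OF N_mod(2)] mod1[OF N_mod(1)] S(3) ne in \<open>simp_all add: mods, linarith?\<close>)
  next
    case 3
    have sub: "N - Suc 0 = 6 * n + 1" "N - 2 = 6 * n + 0"
      "2 * N - Suc 0 = 12 * n + 3" "2 * N - 2 = 12 * n + 2"
      using 3 by simp_all
    have ne: "N \<noteq> 3"
      using 3 by simp_all
    have N_mod: "N mod 3 = 2" "even N"
      unfolding 3 even_iff_mod_2_eq_zero odd_iff_mod_2_eq_one mod_shift by simp_all
    have mods: "2 * (N - Suc 0) mod 3 = 2" "2 * (N - 2) mod 3 = 0"
      "(N - Suc 0) mod 2 = 1" "(N - 2) mod 2 = 0"
      "2 * (2 * N - Suc 0) mod 3 = 0" "2 * (2 * N - 2) mod 3 = 1"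
      "(2 * N - Suc 0) mod 2 = 1" "(2 * N - 2) mod 2 = 0"
      unfolding sub mod_shift by simp_all
    \<comment> \<open>For \<open>N = 2\<close> every one-edge path must be doubled, its defect being
      1; the count of edges shows that there is room.\<close>
    have small: "2 * S1 + S2 \<le> k" if "N = 2"
      using even[OF N_mod(2)] size that by simp
    \<comment> \<open>Doubling a one-edge path saves two two-cycles at the same number of
      triangles.\<close>
    show ?thesis
      by (rule double[of "min S1 (k - S1 - S2)" 0])
        (use even[OF N_mod(2)] mod2[OF N_mod(1)] S(3) ne small in \<open>simp_all add: mods, linarith?\<close>)
  next
    case 4
    have sub: "N - Suc 0 = 6 * n + 2" "N - 2 = 6 * n + 1"
      "2 * N - Suc 0 = 12 * n + 5" "2 * N - 2 = 12 * n + 4"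
      using 4 by simp_all
    have ne: "N \<noteq> 2"
      using 4 by simp_all
    have N_mod: "N mod 3 = 0" "odd N"
      unfolding 4 even_iff_mod_2_eq_zero odd_iff_mod_2_eq_one mod_shift by simp_all
    have mods: "2 * (N - Suc 0) mod 3 = 1" "2 * (N - 2) mod 3 = 2"
      "(N - Suc 0) mod 2 = 0" "(N - 2) mod 2 = 1"
      "2 * (2 * N - Suc 0) mod 3 = 1" "2 * (2 * N - 2) mod 3 = 2"
      "(2 * N - Suc 0) mod 2 = 1" "(2 * N - 2) mod 2 = 0"
      unfolding sub mod_shift by simp_all
    \<comment> \<open>For \<open>N = 3\<close> every two-edge path must be doubled, for the same
      reason as one-edge paths when \<open>N = 2\<close>.\<close>
    have small: "S1 + 2 * S2 \<le> k" if "N = 3"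
      using mod0[OF N_mod(1)] size that by simp
    \<comment> \<open>Doubling a two-edge path saves one triangle.\<close>
    show ?thesis
      by (rule double[of 0 "min S2 (k - S1 - S2)"])
        (use odd[OF N_mod(2)] mod0[OF N_mod(1)] S(3) ne small in \<open>simp_all add: mods, linarith?\<close>)
  next
    case 5
    have sub: "N - Suc 0 = 6 * n + 3" "N - 2 = 6 * n + 2"
      "2 * N - Suc 0 = 12 * n + 7" "2 * N - 2 = 12 * n + 6"
      using 5 by simp_all
    have ne: "N \<noteq> 2" "N \<noteq> 3"
      using 5 by simp_all
    have N_mod: "N mod 3 = 1" "even N"
      unfolding 5 even_iff_mod_2_eq_zero odd_iff_mod_2_eq_one mod_shift by simp_all
    have mods: "2 * (N - Suc 0) mod 3 = 0" "2 * (N - 2) mod 3 = 1"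
      "(N - Suc 0) mod 2 = 1" "(N - 2) mod 2 = 0"
      "2 * (2 * N - Suc 0) mod 3 = 2" "2 * (2 * N - 2) mod 3 = 0"
      "(2 * N - Suc 0) mod 2 = 1" "(2 * N - 2) mod 2 = 0"
      unfolding sub mod_shift by simp_all
    \<comment> \<open>Doubling a two-edge path saves one two-cycle.\<close>
    show ?thesis
      by (rule double[of 0 "min S2 (k - S1 - S2)"])
        (use even[OF N_mod(2)] mod1[OF N_mod(1)] S(3) ne in \<open>simp_all add: mods, linarith?\<close>)
  next
    case 6
    have sub: "N - Suc 0 = 6 * n + 4" "N - 2 = 6 * n + 3"
      "2 * N - Suc 0 = 12 * n + 9" "2 * N - 2 = 12 * n + 8"
      using 6 by simp_all
    have ne: "N \<noteq> 2" "N \<noteq> 3"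
      using 6 by simp_all
    have N_mod: "N mod 3 = 2" "odd N"
      unfolding 6 even_iff_mod_2_eq_zero odd_iff_mod_2_eq_one mod_shift by simp_all
    have mods: "2 * (N - Suc 0) mod 3 = 2" "2 * (N - 2) mod 3 = 0"
      "(N - Suc 0) mod 2 = 0" "(N - 2) mod 2 = 1"
      "2 * (2 * N - Suc 0) mod 3 = 0" "2 * (2 * N - 2) mod 3 = 1"
      "(2 * N - Suc 0) mod 2 = 1" "(2 * N - 2) mod 2 = 0"
      unfolding sub mod_shift by simp_all
    \<comment> \<open>In this residue class doubling trades one kind of cycle for the other;
      \<open>N \<ge> 5\<close> forces enough cycles in total to pay for the trade.\<close>
    have "5 * k \<le> N * k" by (rule mult_le_mono1) (simp add: 6)
    then have size5: "5 * k \<le> S1 + 2 * S2 + 2 * p + 3 * q"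
      using size by (simp add: mult.commute)
    note odd = odd[OF N_mod(2)] and mod2 = mod2[OF N_mod(1)]
    show ?thesis
    proof (cases "p < 2 * S1")
      case True
      \<comment> \<open>Each doubled one-edge path trades two two-cycles for a triangle, so half the
        shortage, rounded up, is doubled.\<close>
      define i where "i = (2 * S1 - p + 1) div 2"
      have i: "2 * i \<ge> 2 * S1 - p" "2 * i \<le> 2 * S1 - p + 1"
        unfolding i_def by linarith+
      show ?thesis
        by (rule double[of i 0]) (use i ne True odd mod2 S(3) size5 in \<open>simp_all add: mods\<close>)
    next
      case False
      \<comment> \<open>Each doubled two-edge path trades a triangle for a two-cycle;
        \<open>S2 - q\<close> is the shortage of triangles, zero if there is none.\<close>
      show ?thesis
        by (rule double[of 0 "S2 - q"]) (use False ne odd mod2 S(3) size5 in \<open>simp_all add: mods\<close>)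
    qed
  qed
qed

section \<open>Linear inequalities valid for the columns\<close>

definition form :: "int \<times> int \<times> int \<times> int \<times> int \<times> int \<Rightarrow> vec \<Rightarrow> int" where
  "form = (\<lambda>(p, q, r, s, t, u) (a, b, c, d, e, f).
     p * int a + q * int b + r * int c + s * int d + t * int e + u * int f)"

text \<open>Integral inequalities valid for all columns, evaluated on a sum of \<open>k\<close> columns with real weights.\<close>
definition fractional :: "nat \<Rightarrow> nat \<Rightarrow> vec \<Rightarrow> bool" where
  "fractional N k v \<longleftrightarrow>
     (\<forall>z g. (\<forall>x. eulerian x \<and> steps x = N \<longrightarrow> form g x \<le> z) \<longrightarrow> form g v \<le> z * int k)"

lemma fractionalD:
  assumes "fractional N k (a, b, c, d, e, f)"
    and "\<And>a b c d e f. eulerian (a, b, c, d, e, f) \<Longrightarrow> steps (a, b, c, d, e, f) = N \<Longrightarrow>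
      p * int a + q * int b + r * int c + s * int d + t * int e + u * int f \<le> z"
  shows "p * int a + q * int b + r * int c + s * int d + t * int e + u * int f \<le> z * int k"
proof -
  have "\<forall>x. eulerian x \<and> steps x = N \<longrightarrow> form (p, q, r, s, t, u) x \<le> z"
    using assms(2) by (auto simp: form_def)
  then have "form (p, q, r, s, t, u) (a, b, c, d, e, f) \<le> z * int k"
    using assms(1) unfolding fractional_def by blast
  then show ?thesis by (simp add: form_def)
qed

text \<open>\<open>h'\<close> is the action on coefficients dual to \<open>h\<close>: an inequality
  for \<open>h v\<close> is one for \<open>v\<close> with coefficients \<open>h' g\<close>, still
  valid because the set of columns is invariant under \<open>h\<close>.\<close>

lemma fractional_permute:
  assumes "fractional N k v"
    and "\<And>g x. form g (h x) = form (h' g) x"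
    and "\<And>x. eulerian (h x) = eulerian x" "\<And>x. steps (h x) = steps x" "\<And>x. h (h x) = x"
  shows "fractional N k (h v)"
  unfolding fractional_def
proof (intro allI impI)
  fix z g
  assume *: "\<forall>x. eulerian x \<and> steps x = N \<longrightarrow> form g x \<le> z"
  have "\<forall>x. eulerian x \<and> steps x = N \<longrightarrow> form (h' g) x \<le> z"
    using * assms(2-4) by metis
  then have "form (h' g) v \<le> z * int k"
    using assms(1) unfolding fractional_def by blast
  then show "form g (h v) \<le> z * int k" by (simp only: assms(2))
qed

lemma fractional_swap12:
  "fractional N k (a, b, c, d, e, f) \<Longrightarrow> fractional N k (c, d, a, b, f, e)"
  by (drule fractional_permute[of _ _ _ "\<lambda>(a, b, c, d, e, f). (c, d, a, b, f, e)"
        "\<lambda>(a, b, c, d, e, f). (c, d, a, b, f, e)"])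
    (auto simp: eulerian_def edge_values form_def)

lemma fractional_swap23:
  "fractional N k (a, b, c, d, e, f) \<Longrightarrow> fractional N k (b, a, e, f, c, d)"
  by (drule fractional_permute[of _ _ _ "\<lambda>(a, b, c, d, e, f). (b, a, e, f, c, d)"
        "\<lambda>(a, b, c, d, e, f). (b, a, e, f, c, d)"])
    (auto simp: eulerian_def edge_values form_def)

lemma fractional_reverse:
  "fractional N k (a, b, c, d, e, f) \<Longrightarrow> fractional N k (c, e, a, f, b, d)"
  by (drule fractional_permute[of _ _ _ "\<lambda>(a, b, c, d, e, f). (c, e, a, f, b, d)"
        "\<lambda>(a, b, c, d, e, f). (c, e, a, f, b, d)"])
    (auto simp: eulerian_def edge_values form_def)

text \<open>\<open>x\<close> paths 12, \<open>A - x\<close> paths 132, \<open>y\<close> paths 123, \<open>B - y\<close> paths 13, \<open>r\<close> triangles 1321 and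
  \<open>r + \<alpha> - x - y\<close> triangles 1231; all other edges pair up to two-cycles.\<close>
lemma decomposable_xyr:
  fixes x y r A B \<alpha> P :: int
  assumes N: "N \<ge> 2" and size: "a + b + c + d + e + f = k * N"
    and A: "A = int a + int f - int c - int d" and B: "B = int b + int d - int e - int f"
    and \<alpha>: "\<alpha> = int a - int c" and P: "P = int c + int d + int e"
    and k: "A + B \<le> int k"
    and bounds: "0 \<le> x" "x \<le> A" "0 \<le> y" "y \<le> B" "0 \<le> r" "r \<le> int c"
      "0 \<le> r + \<alpha> - x - y" "r + \<alpha> - x - y \<le> int e" "r + \<alpha> - x \<le> int d"
    and even: "even N \<Longrightarrow> B - \<alpha> \<le> 2 * (r - x)"
    and odd: "odd N \<Longrightarrow> 2 * A + B - \<alpha> - int k \<le> 2 * (r - y)"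
    and mod0: "N mod 3 = 0 \<Longrightarrow> 3 * (r - x) \<le> P - 2 * \<alpha> - 2 * A - B"
    and mod1: "N mod 3 = 1 \<Longrightarrow> 3 * (r - x) \<le> P - 2 * \<alpha> - 2 * A - B + int k"
    and mod2: "N mod 3 = 2 \<Longrightarrow> 3 * (r - y) \<le> P - 2 * \<alpha> - 2 * A - 4 * B + 2 * int k"
  shows "decomposable N k (a, b, c, d, e, f)"
proof -
  define s w t u where "s = nat x" and "w = nat (B - y)" and "t = nat (A - x)" and "u = nat y"
  define g h i j l where "g = nat (r + \<alpha> - x - y)" and "h = nat r"
    and "i = nat (int c - r)" and "j = nat (int e - (r + \<alpha> - x - y))"
    and "l = nat (int d - (r + \<alpha> - x))"
  have ints: "int s = x" "int w = B - y" "int t = A - x" "int u = y" "int g = r + \<alpha> - x - y" "int h = r"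
    "int i = int c - r" "int j = int e - (r + \<alpha> - x - y)" "int l = int d - (r + \<alpha> - x)"
    using bounds by (simp_all add: s_def w_def t_def u_def g_def h_def i_def j_def l_def)
  have int_le: "m \<le> m' \<longleftrightarrow> int m \<le> int m'" for m m' by simp
  have v: "a = s + u + (i + g)" "b = t + w + (j + h)" "c = i + h" "d = u + (l + g)" "e = j + g" "f = t + (l + h)"
    using ints A B \<alpha> by linarith+
  have cyc: "cycles (i + j + l) (g + h) (i + g, j + h, i + h, l + g, j + g, l + h)"
    unfolding cycles_def by blast
  \<comment> \<open>There are \<open>P - 3 * r - 2 * \<alpha> + 2 * x + y\<close> two-cycles and
    \<open>2 * r + \<alpha> - x - y\<close> triangles, so each budget becomes a bound on
    \<open>r - x\<close> or \<open>r - y\<close> alone.\<close>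
  have "decomposable N k ((s + u, t + w, 0, u, 0, t) + (i + g, j + h, i + h, l + g, j + g, l + h))"
  proof (rule decomposable_budget[OF N cyc refl refl])
    show "s + w + (t + u) \<le> k"
      unfolding int_le of_nat_add of_nat_mult of_nat_numeral ints using k by simp
    show "s + w + 2 * (t + u) + 2 * (i + j + l) + 3 * (g + h) = k * N"
      unfolding size[symmetric] by (subst v)+ simp
    show "s + w \<le> g + h" if "even N"
      unfolding int_le of_nat_add of_nat_mult of_nat_numeral ints using even[OF that] by (simp add: algebra_simps)
    show "s + w + 2 * (t + u) \<le> g + h + k" if "odd N"
      unfolding int_le of_nat_add of_nat_mult of_nat_numeral ints using odd[OF that] by (simp add: algebra_simps)
    show "s + w + 2 * (t + u) \<le> i + j + l" if "N mod 3 = 0"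
      unfolding int_le of_nat_add of_nat_mult of_nat_numeral ints using mod0[OF that, unfolded P] by (simp add: algebra_simps)
    show "s + w + 2 * (t + u) \<le> i + j + l + k" if "N mod 3 = 1"
      unfolding int_le of_nat_add of_nat_mult of_nat_numeral ints using mod1[OF that, unfolded P] by (simp add: algebra_simps)
    show "4 * (s + w) + 2 * (t + u) \<le> i + j + l + 2 * k" if "N mod 3 = 2"
      unfolding int_le of_nat_add of_nat_mult of_nat_numeral ints using mod2[OF that, unfolded P] by (simp add: algebra_simps)
  qed
  then show ?thesis by (simp add: v)
qed

text \<open>Parity yields one proper lower bound, \<open>LE\<close> or \<open>LG\<close>, and the
  residue modulo 3 one proper upper bound, \<open>UE\<close> or \<open>UG\<close>. The other two are
  the values \<open>- A\<close>, \<open>- B\<close> or \<open>c\<close> already implied by the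
  ranges of \<open>x\<close>, \<open>y\<close>, \<open>r\<close>. The pairwise conditions of
  \<open>interval_system_solvable\<close> then follow linearly from the valid inequalities and the
  size bound.\<close>

lemma chamber_solvable:
  fixes a b c d e f k S A B \<alpha> P LE UE LG UG :: int
  assumes nonneg: "0 \<le> a" "0 \<le> b" "0 \<le> c" "0 \<le> d" "0 \<le> e" "0 \<le> f" "0 \<le> k"
    and S: "S = a + b + c + d + e + f"
    and A: "A = a + f - c - d" and B: "B = b + d - e - f" and AB: "0 \<le> B" "B \<le> A" "A + B \<le> k"
    and \<alpha>: "\<alpha> = a - c" and P: "P = c + d + e"
    and parity: "even_case \<and> 2 * LE = S - 2 * P - 2 * A \<and> LG = - B \<and>
        2 * a + 2 * b \<le> S \<and> 2 * b + 2 * d \<le> S \<and> 2 * a + 2 * f \<le> S \<or>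
      \<not> even_case \<and> LE = - A \<and> 2 * LG = S - k - 2 * P \<and>
        2 * a + 2 * b + 2 * f - 2 * c \<le> S + k \<and> 2 * a + 2 * b + 2 * d - 2 * e \<le> S + k"
      (is "_ \<and> ?even \<or> _ \<and> ?odd")
    and mod3: "m = 0 \<and> 3 * UE = 2 * S - 3 * P - 6 * A - 3 * B \<and> UG = c \<and>
        3 * a + 3 * b + 3 * d \<le> 2 * S \<and> 3 * a + 3 * b + 3 * f \<le> 2 * S \<or>
      m = (1::nat) \<and> 3 * UE = 2 * S + k - 3 * P - 6 * A - 3 * B \<and> UG = c \<and>
        3 * a + 3 * b + 3 * d \<le> 2 * S + k \<and> 3 * a + 3 * b + 3 * f \<le> 2 * S + k \<or>
      m = 2 \<and> UE = c \<and> 3 * UG = 2 * S + 2 * k - 3 * P - 6 * A - 6 * B \<and>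
        6 * a + 3 * b + 3 * f - 3 * c \<le> 2 * S + 2 * k \<and> 6 * b + 3 * a + 3 * d - 3 * e \<le> 2 * S + 2 * k"
      (is "_ \<and> ?mod0 \<or> _ \<and> ?mod1 \<or> _ \<and> ?mod2")
    and size: "even_case \<and> m = 0 \<and> 6 * k \<le> S \<or> even_case \<and> m = 1 \<and> 4 * k \<le> S \<or>
      even_case \<and> m = 2 \<and> 2 * k \<le> S \<or> \<not> even_case \<and> m = 0 \<and> 3 * k \<le> S \<or>
      \<not> even_case \<and> m = 1 \<and> 7 * k \<le> S \<or> \<not> even_case \<and> m = 2 \<and> 5 * k \<le> S"
  obtains x y r where "0 \<le> x" "x \<le> A" "0 \<le> y" "y \<le> B" "0 \<le> r" "r \<le> c"
    "0 \<le> r + \<alpha> - x - y" "r + \<alpha> - x - y \<le> e" "r + \<alpha> - x \<le> d"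
    "LE \<le> r - x" "r - x \<le> UE" "LG \<le> r - y" "r - y \<le> UG"
proof -
  have pairs: "\<forall>l\<in>{LE, - A, - \<alpha>, LG - A, - \<alpha> - UG, LG - A - UG}.
      \<forall>u\<in>{UE, d - \<alpha>, c, e - \<alpha> + B, UG + B, e - \<alpha> - LG + c, UG - LG + c}. l \<le> u"
    "\<forall>l\<in>{- \<alpha>, LG - A}. \<forall>u\<in>{e - \<alpha>, UG}. l \<le> u"
    "- B \<le> UG" "LG \<le> c" "LG \<le> UG"
  proof -
    consider "even_case" "m = 0" | "even_case" "m = 1" | "even_case" "m = 2"
      | "\<not> even_case" "m = 0" | "\<not> even_case" "m = 1" | "\<not> even_case" "m = 2"
      using size by blast
    then have "(\<forall>l\<in>{LE, - A, - \<alpha>, LG - A, - \<alpha> - UG, LG - A - UG}.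
        \<forall>u\<in>{UE, d - \<alpha>, c, e - \<alpha> + B, UG + B, e - \<alpha> - LG + c, UG - LG + c}. l \<le> u) \<and>
      (\<forall>l\<in>{- \<alpha>, LG - A}. \<forall>u\<in>{e - \<alpha>, UG}. l \<le> u) \<and> - B \<le> UG \<and> LG \<le> c \<and> LG \<le> UG"
    proof cases
      case 1
      then have ?even ?mod0 "6 * k \<le> S" using parity mod3 size by simp_all
      then show ?thesis
        using nonneg AB S A B \<alpha> P unfolding ball_simps
        by (-, elim conjE, (intro conjI TrueI; smt (verit)))
    next
      case 2
      then have ?even ?mod1 "4 * k \<le> S" using parity mod3 size by simp_all
      then show ?thesis
        using nonneg AB S A B \<alpha> P unfolding ball_simps
        by (-, elim conjE, (intro conjI TrueI; smt (verit)))
    next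
      case 3
      then have ?even ?mod2 "2 * k \<le> S" using parity mod3 size by simp_all
      then show ?thesis
        using nonneg AB S A B \<alpha> P unfolding ball_simps
        by (-, elim conjE, (intro conjI TrueI; smt (verit)))
    next
      case 4
      then have ?odd ?mod0 "3 * k \<le> S" using parity mod3 size by simp_all
      then show ?thesis
        using nonneg AB S A B \<alpha> P unfolding ball_simps
        by (-, elim conjE, (intro conjI TrueI; smt (verit)))
    next
      case 5
      then have ?odd ?mod1 "7 * k \<le> S" using parity mod3 size by simp_all
      then show ?thesis
        using nonneg AB S A B \<alpha> P unfolding ball_simps
        by (-, elim conjE, (intro conjI TrueI; smt (verit)))
    next
      case 6
      then have ?odd ?mod2 "5 * k \<le> S" using parity mod3 size by simp_all
      then show ?thesis
        using nonneg AB S A B \<alpha> P unfolding ball_simps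
        by (-, elim conjE, (intro conjI TrueI; smt (verit)))
    qed
    then show "\<forall>l\<in>{LE, - A, - \<alpha>, LG - A, - \<alpha> - UG, LG - A - UG}.
      \<forall>u\<in>{UE, d - \<alpha>, c, e - \<alpha> + B, UG + B, e - \<alpha> - LG + c, UG - LG + c}. l \<le> u"
    "\<forall>l\<in>{- \<alpha>, LG - A}. \<forall>u\<in>{e - \<alpha>, UG}. l \<le> u"
    "- B \<le> UG" "LG \<le> c" "LG \<le> UG" by blast+
  qed
  note solution = that
  show thesis
  proof (rule interval_system_solvable[of LE A \<alpha> LG UG UE d c e B])
    show "l \<le> u" if "l \<in> {LE, - A, - \<alpha>, LG - A, - \<alpha> - UG, LG - A - UG}"
      "u \<in> {UE, d - \<alpha>, c, e - \<alpha> + B, UG + B, e - \<alpha> - LG + c, UG - LG + c}" for l u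
      using pairs(1) that by blast
    show "l \<le> u" if "l \<in> {- \<alpha>, LG - A}" "u \<in> {e - \<alpha>, UG}" for l u
      using pairs(2) that by blast
    show "0 \<le> A" "0 \<le> B" "0 \<le> c" using AB nonneg by linarith+
  qed (fact pairs solution)+
qed

text \<open>Vertex 1 is the source, and vertices 2 and 3 absorb \<open>A \<ge> B \<ge> 0\<close>.
  The valid inequalities feed \<open>chamber_solvable\<close>, whose integer solution is passed to
  \<open>decomposable_xyr\<close>.\<close>

lemma chamber:
  assumes N: "N \<ge> 2" and frac: "fractional N k (a, b, c, d, e, f)"
    and size: "a + b + c + d + e + f = k * N"
    and order: "int c + int d + int b + int d \<le> int a + int f + int e + int f" "int e + int f \<le> int b + int d"
  shows "decomposable N k (a, b, c, d, e, f)"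
proof -
  define A B \<alpha> P S where "A = int a + int f - int c - int d" and "B = int b + int d - int e - int f"
    and "\<alpha> = int a - int c" and "P = int c + int d + int e" and "S = int k * int N"
  note defs = this
  have S: "S = int a + int b + int c + int d + int e + int f"
    using arg_cong[OF size, of int] by (simp add: S_def)
  have AB: "0 \<le> B" "B \<le> A" using order by (simp_all add: defs)
  \<comment> \<open>The validity check runs over integer points only, so each bound \<open>z\<close>
    below may be rounded down according to the residue of \<open>N\<close>.\<close>
  have facet: "p * int a + q * int b + r * int c + s * int d + t * int e + u * int f \<le> z * int k"
    if "\<And>a b c d e f. \<lbrakk>0 \<le> a; 0 \<le> b; 0 \<le> c; 0 \<le> d; 0 \<le> e; 0 \<le> f; a + b + c + d + e + f = int N;
        a + b - c - e \<le> 1; c + e - a - b \<le> 1; c + d - a - f \<le> 1; a + f - c - d \<le> 1;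
        e + f - b - d \<le> 1; b + d - e - f \<le> 1\<rbrakk> \<Longrightarrow>
      p * a + q * b + r * c + s * d + t * e + u * f \<le> z" for p q r s t u z
    by (rule fractionalD[OF frac], rule that) (auto simp: eulerian_def edge_values)
  \<comment> \<open>\<open>A + B\<close> is the net outflow of vertex 1, which is at most 1 for each
    column.\<close>
  have k: "A + B \<le> int k"
    using facet[of 1 1 "- 1" 0 "- 1" 0 1] by (simp add: defs)
  \<comment> \<open>The divisions by 2 here, and by 3 below, are exact because
    \<open>S = k * N\<close>; this makes the bounds integers.\<close>
  obtain LE LG where par: "even N \<and> 2 * LE = S - 2 * P - 2 * A \<and> LG = - B \<and>
        2 * int a + 2 * int b \<le> S \<and> 2 * int b + 2 * int d \<le> S \<and> 2 * int a + 2 * int f \<le> S \<or>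
      \<not> even N \<and> LE = - A \<and> 2 * LG = S - int k - 2 * P \<and>
        2 * int a + 2 * int b + 2 * int f - 2 * int c \<le> S + int k \<and>
        2 * int a + 2 * int b + 2 * int d - 2 * int e \<le> S + int k"
  proof (cases "even N")
    case True
    then obtain M where M: "N = 2 * M" by (elim evenE)
    have F1: "int a + int b \<le> int M * int k"
      using facet[of 1 1 0 0 0 0 "int M"] by (simp add: M)
    have F2: "int b + int d \<le> int M * int k"
      using facet[of 0 1 0 1 0 0 "int M"] by (simp add: M)
    have F3: "int a + int f \<le> int M * int k"
      using facet[of 1 0 0 0 0 1 "int M"] by (simp add: M)
    show ?thesis
      by (rule that[of "int M * int k - P - A" "- B"])
        (use F1 F2 F3 True in \<open>simp add: S_def M algebra_simps\<close>)
  next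
    case False
    then obtain M where M: "N = 2 * M + 1" by (elim oddE)
    have F1: "int a + int b - int c + int f \<le> (int M + 1) * int k"
      using facet[of 1 1 "- 1" 0 0 1 "int M + 1"] by (simp add: M)
    have F2: "int a + int b + int d - int e \<le> (int M + 1) * int k"
      using facet[of 1 1 0 1 "- 1" 0 "int M + 1"] by (simp add: M)
    show ?thesis
      by (rule that[of "- A" "int M * int k - P"])
        (use F1 F2 False in \<open>simp add: S_def M algebra_simps\<close>)
  qed
  obtain UE UG where md: "N mod 3 = 0 \<and> 3 * UE = 2 * S - 3 * P - 6 * A - 3 * B \<and> UG = int c \<and>
        3 * int a + 3 * int b + 3 * int d \<le> 2 * S \<and> 3 * int a + 3 * int b + 3 * int f \<le> 2 * S \<or>
      N mod 3 = 1 \<and> 3 * UE = 2 * S + int k - 3 * P - 6 * A - 3 * B \<and> UG = int c \<and>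
        3 * int a + 3 * int b + 3 * int d \<le> 2 * S + int k \<and>
        3 * int a + 3 * int b + 3 * int f \<le> 2 * S + int k \<or>
      N mod 3 = 2 \<and> UE = int c \<and> 3 * UG = 2 * S + 2 * int k - 3 * P - 6 * A - 6 * B \<and>
        6 * int a + 3 * int b + 3 * int f - 3 * int c \<le> 2 * S + 2 * int k \<and>
        6 * int b + 3 * int a + 3 * int d - 3 * int e \<le> 2 * S + 2 * int k"
  proof -
    define M where "M = N div 3"
    have M: "N = 3 * M + N mod 3" and "N mod 3 < 3" by (simp_all add: M_def)
    then have "N mod 3 = 0 \<or> N mod 3 = 1 \<or> N mod 3 = 2" by linarith
    then consider "N mod 3 = 0" "N = 3 * M" | "N mod 3 = 1" "N = 3 * M + 1" | "N mod 3 = 2" "N = 3 * M + 2"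
      using M by fastforce
    then show ?thesis
    proof cases
      case 1
      have F1: "int a + int b + int d \<le> (2 * int M) * int k"
        using facet[of 1 1 0 1 0 0 "2 * int M"] by (simp add: 1)
      have F2: "int a + int b + int f \<le> (2 * int M) * int k"
        using facet[of 1 1 0 0 0 1 "2 * int M"] by (simp add: 1)
      show ?thesis
      by (rule that[of "2 * int M * int k - P - 2 * A - B" "int c"])
        (use F1 F2 1 in \<open>simp add: S_def algebra_simps\<close>)
    next
      case 2
      have F1: "int a + int b + int d \<le> (2 * int M + 1) * int k"
        using facet[of 1 1 0 1 0 0 "2 * int M + 1"] by (simp add: 2)
      have F2: "int a + int b + int f \<le> (2 * int M + 1) * int k"
        using facet[of 1 1 0 0 0 1 "2 * int M + 1"] by (simp add: 2)
      show ?thesis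
      by (rule that[of "(2 * int M + 1) * int k - P - 2 * A - B" "int c"])
        (use F1 F2 2 in \<open>simp add: S_def algebra_simps\<close>)
    next
      case 3
      have F1: "2 * int a + int b - int c + int f \<le> (2 * int M + 2) * int k"
        using facet[of 2 1 "- 1" 0 0 1 "2 * int M + 2"] by (simp add: 3)
      have F2: "int a + 2 * int b + int d - int e \<le> (2 * int M + 2) * int k"
        using facet[of 1 2 0 1 "- 1" 0 "2 * int M + 2"] by (simp add: 3)
      show ?thesis
      by (rule that[of "int c" "(2 * int M + 2) * int k - P - 2 * A - 2 * B"])
        (use F1 F2 3 in \<open>simp add: S_def algebra_simps\<close>)
    qed
  qed
  have size_le: "int m * int k \<le> S" if "m \<le> N" for m
    using mult_right_mono[of "int m" "int N" "int k"] that by (simp add: S_def mult.commute)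
  \<comment> \<open>The numbers 6, 4, 2, 3, 7, 5 are the least \<open>N \<ge> 2\<close> in the six
    classes modulo 6.\<close>
  have "even N \<and> N mod 3 = 0 \<and> 6 \<le> N \<or> even N \<and> N mod 3 = 1 \<and> 4 \<le> N \<or>
    even N \<and> N mod 3 = 2 \<and> 2 \<le> N \<or> odd N \<and> N mod 3 = 0 \<and> 3 \<le> N \<or>
    odd N \<and> N mod 3 = 1 \<and> 7 \<le> N \<or> odd N \<and> N mod 3 = 2 \<and> 5 \<le> N"
    using N by presburger
  then have sizes: "even N \<and> N mod 3 = 0 \<and> 6 * int k \<le> S \<or> even N \<and> N mod 3 = 1 \<and> 4 * int k \<le> S \<or>
    even N \<and> N mod 3 = 2 \<and> 2 * int k \<le> S \<or> odd N \<and> N mod 3 = 0 \<and> 3 * int k \<le> S \<or>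
    odd N \<and> N mod 3 = 1 \<and> 7 * int k \<le> S \<or> odd N \<and> N mod 3 = 2 \<and> 5 * int k \<le> S"
    using size_le[of 6] size_le[of 4] size_le[of 2] size_le[of 3] size_le[of 7] size_le[of 5]
    unfolding of_nat_numeral by blast
  obtain x y r where xyr: "0 \<le> x" "x \<le> A" "0 \<le> y" "y \<le> B" "0 \<le> r" "r \<le> int c"
    "0 \<le> r + \<alpha> - x - y" "r + \<alpha> - x - y \<le> int e" "r + \<alpha> - x \<le> int d"
    "LE \<le> r - x" "r - x \<le> UE" "LG \<le> r - y" "r - y \<le> UG"
    by (rule chamber_solvable[OF of_nat_0_le_iff of_nat_0_le_iff of_nat_0_le_iff of_nat_0_le_iff
        of_nat_0_le_iff of_nat_0_le_iff of_nat_0_le_iff S defs(1,2) AB k defs(3,4) par md sizes]) (rule that)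
  show ?thesis
  proof (rule decomposable_xyr[OF N size defs(1-4) k xyr(1-9)])
    show "B - \<alpha> \<le> 2 * (r - x)" if "even N"
      using par that xyr(10) S by (simp add: defs)
    show "2 * A + B - \<alpha> - int k \<le> 2 * (r - y)" if "odd N"
      using par that xyr(12) S by (simp add: defs)
    show "3 * (r - x) \<le> P - 2 * \<alpha> - 2 * A - B" if "N mod 3 = 0"
      using md that xyr(11) S by (simp add: defs)
    show "3 * (r - x) \<le> P - 2 * \<alpha> - 2 * A - B + int k" if "N mod 3 = 1"
      using md that xyr(11) S by (simp add: defs)
    show "3 * (r - y) \<le> P - 2 * \<alpha> - 2 * A - 4 * B + 2 * int k" if "N mod 3 = 2"
      using md that xyr(13) S by (simp add: defs)
  qed
qed

section \<open>Reduction to one chamber by symmetry\<close>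

lemma chamber_one_source:
  assumes N: "N \<ge> 2" and frac: "fractional N k (a, b, c, d, e, f)"
    and size: "a + b + c + d + e + f = k * N"
    and source: "c + d \<le> a + f" "e + f \<le> b + d"
  shows "decomposable N k (a, b, c, d, e, f)"
proof (cases "c + d + b + d \<le> a + f + e + f")
  case True
  show ?thesis by (rule chamber[OF N frac size]) (use True source in linarith)+
next
  case False
  show ?thesis
    by (rule decomposable_swap23, rule chamber[OF N fractional_swap23[OF frac]])
      (use False source size in linarith)+
qed

text \<open>If two net outflows are nonpositive, relabelling makes vertex 1 the source. Otherwise
  two are positive, and reversing all edges leads back to the first case.\<close>

lemma fractional_decomposable:
  assumes N: "N \<ge> 2" and frac: "fractional N k (a, b, c, d, e, f)"
    and size: "a + b + c + d + e + f = k * N"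
  shows "decomposable N k (a, b, c, d, e, f)"
proof -
  have one_source: "decomposable N k (a, b, c, d, e, f)"
    if frac: "fractional N k (a, b, c, d, e, f)" and size: "a + b + c + d + e + f = k * N"
      and "c + d \<le> a + f \<and> e + f \<le> b + d \<or> a + b \<le> c + e \<and> e + f \<le> b + d \<or>
        a + b \<le> c + e \<and> c + d \<le> a + f" for a b c d e f
    using that(3)
  proof (elim disjE conjE)
    assume "c + d \<le> a + f" "e + f \<le> b + d"
    then show ?thesis by (rule chamber_one_source[OF N frac size])
  next
    assume "a + b \<le> c + e" "e + f \<le> b + d"
    then show ?thesis
      by (intro decomposable_swap12[OF chamber_one_source[OF N fractional_swap12[OF frac]]])
        (use size in linarith)+
  next
    assume "a + b \<le> c + e" "c + d \<le> a + f"
    then show ?thesis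
      by (intro decomposable_swap23[OF decomposable_swap12[OF chamber_one_source[OF N
              fractional_swap12[OF fractional_swap23[OF frac]]]]])
        (use size in linarith)+
  qed
  show ?thesis
  proof (cases "c + d \<le> a + f \<and> e + f \<le> b + d \<or> a + b \<le> c + e \<and> e + f \<le> b + d \<or>
      a + b \<le> c + e \<and> c + d \<le> a + f")
    case True
    then show ?thesis by (rule one_source[OF frac size])
  next
    case False
    show ?thesis
      by (rule decomposable_reverse, rule one_source[OF fractional_reverse[OF frac]])
        (use False size in linarith)+
  qed
qed

section \<open>From the cone to the semigroup\<close>

definition edge_function :: "vec \<Rightarrow> nat \<times> nat \<Rightarrow> real" where
  "edge_function = (\<lambda>(a, b, c, d, e, f) p.
     if p = (1,2) then real a else if p = (1,3) then real b else if p = (2,1) then real c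
     else if p = (2,3) then real d else if p = (3,1) then real e else if p = (3,2) then real f
     else 0)"

lemma edge_function_0: "edge_function 0 p = 0"
  by (simp add: edge_function_def zero_prod_def)

lemma edge_function_add: "edge_function (x + y) p = edge_function x p + edge_function y p"
  by (cases x; cases y) (simp add: edge_function_def)

lemma col_eq_edge_function: "col w = edge_function (counts w)"
  by (rule ext) (auto simp: col_def counts_def edge_function_def Pairs_def)

lemma Omega_eq_walks: "Omega (Suc N) = {w. walk w \<and> length w = Suc N}"
  by (auto simp: Omega_def walk_def successively_conv_nth)

lemma finite_Omega: "finite (Omega T)"
  by (rule finite_subset[OF _ finite_lists_length_eq[of "{1,2,3}" T]]) (auto simp: Omega_def)

lemma NA_add_col:
  assumes "v \<in> NA T" "w \<in> Omega T"
  shows "(\<lambda>p. col w p + v p) \<in> NA T"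
proof -
  obtain c where c: "v = (\<lambda>p. \<Sum>w\<in>Omega T. real (c w) * col w p)"
    using assms(1) by (auto simp: NA_def)
  have "(\<Sum>u\<in>Omega T. real ((c(w := Suc (c w))) u) * col u p) = col w p + v p" for p
    using assms(2) finite_Omega[of T] by (simp add: c sum.remove[of _ w] algebra_simps)
  then show ?thesis
    unfolding NA_def by (intro CollectI exI[of _ "c(w := Suc (c w))"]) simp
qed

text \<open>Euler's theorem turns each summand into the column of a word with \<open>N\<close>
  edges, and columns are added one at a time.\<close>

lemma decomposable_in_NA:
  assumes "decomposable N k x"
  shows "edge_function x \<in> NA (Suc N)"
proof -
  obtain xs where xs: "sum_list xs = x" "\<forall>x\<in>set xs. eulerian x \<and> steps x = N"
    using assms by (auto simp: decomposable_def)
  from xs(2) have "edge_function (sum_list xs) \<in> NA (Suc N)"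
  proof (induction xs)
    case Nil
    have "edge_function 0 = (\<lambda>p. \<Sum>w\<in>Omega (Suc N). real 0 * col w p)"
      by (rule ext) (simp add: edge_function_0)
    then show ?case unfolding NA_def by (auto intro!: exI[of _ "\<lambda>_. 0"])
  next
    case (Cons y ys)
    then obtain w where w: "walk w" "counts w = y" using eulerian_walk[of y] by auto
    then have "length w = Suc N"
      using walk_counts(1)[OF w(1)] Cons.prems by (cases w) (auto simp: walk_def)
    then have "w \<in> Omega (Suc N)" using w(1) by (simp add: Omega_eq_walks)
    moreover have "edge_function (sum_list ys) \<in> NA (Suc N)" using Cons by simp
    ultimately have "(\<lambda>p. col w p + edge_function (sum_list ys) p) \<in> NA (Suc N)"
      by (rule NA_add_col[rotated])
    then show ?case
      by (simp add: col_eq_edge_function w(2) edge_function_add[abs_def])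
  qed
  then show ?thesis by (simp add: xs(1))
qed

lemma NA_subset: "NA T \<subseteq> ZA T \<inter> coneA T"
proof
  fix v
  assume "v \<in> NA T"
  then obtain c where c: "v = (\<lambda>p. \<Sum>w\<in>Omega T. real (c w) * col w p)"
    by (auto simp: NA_def)
  then show "v \<in> ZA T \<inter> coneA T"
    unfolding ZA_def coneA_def
    by (auto intro!: exI[of _ "\<lambda>w. int (c w)"] exI[of _ "\<lambda>w. real (c w)"])
qed

lemma linear_form_sum:
  fixes h :: "nat list \<Rightarrow> real"
  assumes "v = (\<lambda>p. \<Sum>w\<in>W. h w * col w p)"
  shows "p * v (1,2) + q * v (1,3) + r * v (2,1) + s * v (2,3) + t * v (3,1) + u * v (3,2) =
    (\<Sum>w\<in>W. h w * (p * xcount (1,2) w + q * xcount (1,3) w + r * xcount (2,1) w +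
      s * xcount (2,3) w + t * xcount (3,1) w + u * xcount (3,2) w))"
  by (simp add: assms col_def Pairs_def sum_distrib_left sum.distrib[symmetric] algebra_simps)

lemma cone_subset:
  assumes "N \<ge> 2"
  shows "ZA (Suc N) \<inter> coneA (Suc N) \<subseteq> NA (Suc N)"
proof
  fix v
  assume v: "v \<in> ZA (Suc N) \<inter> coneA (Suc N)"
  from v obtain c where c: "v = (\<lambda>p. \<Sum>w\<in>Omega (Suc N). real_of_int (c w) * col w p)"
    unfolding ZA_def by blast
  from v obtain h where h: "v = (\<lambda>p. \<Sum>w\<in>Omega (Suc N). h w * col w p)" "\<And>w. 0 \<le> h w"
    unfolding coneA_def by blast
  let ?W = "Omega (Suc N)"
  have W: "walk w" "steps (counts w) = N" if "w \<in> ?W" for w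
    using that walk_counts(1)[of w] by (auto simp: Omega_eq_walks)
  have steps: "1 * real (xcount (1,2) w) + 1 * real (xcount (1,3) w) + 1 * real (xcount (2,1) w) +
      1 * real (xcount (2,3) w) + 1 * real (xcount (3,1) w) + 1 * real (xcount (3,2) w) = real N"
    if "w \<in> ?W" for w
    using arg_cong[OF W(2)[OF that], of real] by (simp add: counts_def edge_values)
  have "\<exists>n::nat. v p = real n" for p
  proof -
    \<comment> \<open>The integer combination makes each entry an integer, the conic one makes it
      nonnegative.\<close>
    define m where "m = (\<Sum>w\<in>?W. c w * (if p \<in> Pairs then int (xcount p w) else 0))"
    have "v p = real_of_int m"
      by (auto simp: c m_def col_def intro!: sum.cong)
    moreover have "0 \<le> v p"
      unfolding h(1) by (intro sum_nonneg mult_nonneg_nonneg h(2)) (simp add: col_def)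
    ultimately have "v p = real (nat m)" by simp
    then show ?thesis by blast
  qed
  then obtain n where n: "\<And>p. v p = real (n p)" by metis
  have vec: "v = edge_function (n (1,2), n (1,3), n (2,1), n (2,3), n (3,1), n (3,2))"
  proof
    fix p
    have "v p = 0" if "p \<notin> Pairs" using that by (simp add: c col_def)
    then show "v p = edge_function (n (1,2), n (1,3), n (2,1), n (2,3), n (3,1), n (3,2)) p"
      using n[of p] by (auto simp: edge_function_def Pairs_def)
  qed
  \<comment> \<open>Every column has entry sum \<open>N > 0\<close>, so the integer and the real
    representation of \<open>v\<close> have the same coefficient sum; it is a nonnegative integer,
    the number of columns sought.\<close>
  define K where "K = (\<Sum>w\<in>?W. c w)"
  have total: "1 * v (1,2) + 1 * v (1,3) + 1 * v (2,1) + 1 * v (2,3) + 1 * v (3,1) + 1 * v (3,2) =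
      (\<Sum>w\<in>?W. g w) * real N" if "v = (\<lambda>p. \<Sum>w\<in>?W. g w * col w p)" for g
    unfolding linear_form_sum[OF that] sum_distrib_right
    by (rule sum.cong[OF refl]) (simp only: steps)
  have K: "real_of_int K = (\<Sum>w\<in>?W. h w)"
    using total[OF c] total[OF h(1)] assms by (simp add: K_def)
  moreover have "0 \<le> (\<Sum>w\<in>?W. h w)" by (intro sum_nonneg h(2))
  ultimately have "0 \<le> K" by linarith
  define k where "k = nat K"
  have k: "real k = (\<Sum>w\<in>?W. h w)" using K \<open>0 \<le> K\<close> by (simp add: k_def)
  have "real (n (1,2) + n (1,3) + n (2,1) + n (2,3) + n (3,1) + n (3,2)) = real (k * N)"
    using total[OF h(1)] by (simp add: n k)
  then have size: "n (1,2) + n (1,3) + n (2,1) + n (2,3) + n (3,1) + n (3,2) = k * N"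
    using of_nat_eq_iff by blast
  have "fractional N k (n (1,2), n (1,3), n (2,1), n (2,3), n (3,1), n (3,2))"
    unfolding fractional_def
  proof (intro allI impI)
    fix z g
    assume valid: "\<forall>x. eulerian x \<and> steps x = N \<longrightarrow> form g x \<le> z"
    obtain p q r s t u where g: "g = (p, q, r, s, t, u)" by (cases g)
    have le: "real_of_int p * xcount (1,2) w + real_of_int q * xcount (1,3) w + real_of_int r * xcount (2,1) w +
      real_of_int s * xcount (2,3) w + real_of_int t * xcount (3,1) w + real_of_int u * xcount (3,2) w \<le> real_of_int z"
      if "w \<in> ?W" for w
    proof -
      have "form g (counts w) \<le> z" using valid W[OF that] eulerian_counts by blast
      then have "real_of_int (form g (counts w)) \<le> real_of_int z" by (simp only: of_int_le_iff)
      then show ?thesis by (simp add: form_def g counts_def)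
    qed
    \<comment> \<open>Averaging: an inequality valid for each column is summed with the nonnegative
      weights \<open>h\<close>, whose total is \<open>k\<close>.\<close>
    have "real_of_int p * v (1,2) + real_of_int q * v (1,3) + real_of_int r * v (2,1) +
      real_of_int s * v (2,3) + real_of_int t * v (3,1) + real_of_int u * v (3,2) \<le> (\<Sum>w\<in>?W. h w * real_of_int z)"
      unfolding linear_form_sum[OF h(1)] by (intro sum_mono mult_left_mono le h(2))
    also have "\<dots> = real_of_int (z * int k)"
      by (simp add: k sum_distrib_left mult.commute)
    finally have "real_of_int (form g (n (1,2), n (1,3), n (2,1), n (2,3), n (3,1), n (3,2)))
        \<le> real_of_int (z * int k)"
      by (simp add: form_def g n)
    then show "form g (n (1,2), n (1,3), n (2,1), n (2,3), n (3,1), n (3,2)) \<le> z * int k"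
      by (simp only: of_int_le_iff)
  qed
  then have "decomposable N k (n (1,2), n (1,3), n (2,1), n (2,3), n (3,1), n (3,2))"
    using fractional_decomposable[OF assms] size by blast
  then show "v \<in> NA (Suc N)"
    unfolding vec by (rule decomposable_in_NA)
qed

theorem theorem2:
  fixes T :: nat
  assumes "T \<ge> 3"
  shows "NA T = ZA T \<inter> coneA T"
proof -
  obtain N where "T = Suc N" "N \<ge> 2" using assms by (cases T) auto
  then show ?thesis using NA_subset[of T] cone_subset[of N] by auto
qed

end
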